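(* Let $n\ge 2$ be an integer, $k,c_b>0$, $\rho_0>0$, and let $\lambda_{1,0},\dots,\lambda_{n,0}$ be real numbers with $\lambda_{1,0}=\cdots=\lambda_{J,0}<\lambda_{J+1,0}\le\cdots\le\lambda_{n,0}$ for some integer $1\le J\le n$. Consider the system $$\lambda_i'=-\lambda_i^2+\frac{k}{n}(\rho-c_b)\ (i=1,\dots,n),\qquad \rho'=-\rho\lambda,\quad \lambda=\sum_{i=1}^n\lambda_i,\qquad \rho(0)=\rho_0,\ \lambda_i(0)=\lambda_{i,0},$$ suppose its maximal interval of existence is $[0,t_B)$ with $0<t_B<\infty$, and let $u_i(t)=e^{\int_0^t\lambda_i(s)\,ds}$. If $J<j\le n$, then there exist constants $0\le q_j\le p_j$ such that $\lim_{t\to t_B^-}u_1'(t)u_j(t)=-p_j$ and $\lim_{t\to t_B^-}u_1(t)u_j'(t)=q_j$.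
   Context: Solutions are real-valued and continuously differentiable on $[0,t_B)$. *)

theory Defs
  imports "HOL-Analysis.Analysis"
begin

definition is_solution ::
  "nat \<Rightarrow> real \<Rightarrow> real \<Rightarrow> real \<Rightarrow> (nat \<Rightarrow> real) \<Rightarrow> real
    \<Rightarrow> (nat \<Rightarrow> real \<Rightarrow> real) \<Rightarrow> (real \<Rightarrow> real) \<Rightarrow> bool" where
  "is_solution n k cb rho0 lam0 T lam rho \<longleftrightarrow>
     0 < T \<and> rho 0 = rho0 \<and> (\<forall>i\<in>{1..n}. lam i 0 = lam0 i) \<and>
     (\<forall>t\<in>{0..<T}.
        (\<forall>i\<in>{1..n}. (lam i has_real_derivative
              (- ((lam i t) ^ 2) + k / real n * (rho t - cb))) (at t within {0..<T})) \<and>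
        (rho has_real_derivative (- rho t * (\<Sum>i=1..n. lam i t))) (at t within {0..<T}))"

definition maximal_solution ::
  "nat \<Rightarrow> real \<Rightarrow> real \<Rightarrow> real \<Rightarrow> (nat \<Rightarrow> real) \<Rightarrow> real
    \<Rightarrow> (nat \<Rightarrow> real \<Rightarrow> real) \<Rightarrow> (real \<Rightarrow> real) \<Rightarrow> bool" where
  "maximal_solution n k cb rho0 lam0 tB lam rho \<longleftrightarrow>
     is_solution n k cb rho0 lam0 tB lam rho \<and>
     (\<nexists>T lam' rho'. T > tB \<and> is_solution n k cb rho0 lam0 T lam' rho' \<and>
        (\<forall>t\<in>{0..<tB}. rho' t = rho t \<and> (\<forall>i\<in>{1..n}. lam' i t = lam i t)))"

definition u_fun :: "(nat \<Rightarrow> real \<Rightarrow> real) \<Rightarrow> nat \<Rightarrow> real \<Rightarrow> real" where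
  "u_fun lam i t = exp (integral {0..t} (lam i))"

end

theory Submission
  imports Defs
begin

text \<open>
  The functions \<open>u i\<close> all solve the linear equation \<open>u'' = \<kappa> * (rho - cb) * u\<close> with
  \<open>\<kappa> = k / n\<close>, and \<open>rho = rho0 / (\<Prod>i. u i)\<close>. Hence the Wronskian of \<open>u 1\<close> and \<open>u j\<close> is the constant
  \<open>w = lam0 j - lam0 1 > 0\<close>, so only \<open>\<beta> = - u 1' * u j\<close> has to be shown to converge, to a limit in
  \<open>[w / 2, w]\<close>; and since all \<open>u i\<close> are combinations of \<open>u 1\<close> and \<open>u h\<close> for \<open>h = J + 1\<close>, it suffices
  to treat \<open>j = h\<close>. Maximality forces \<open>u 1 \<longlongrightarrow> 0\<close>. Dividing the \<open>u i\<close> by a positive solution \<open>\<phi>\<close> of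
  \<open>\<phi>'' = - \<kappa> * cb * \<phi>\<close> makes them convex, which gives \<open>\<beta> \<ge> 0\<close>. If \<open>u h\<close> does not eventually
  increase, then \<open>\<beta> \<longlongrightarrow> w\<close>. Otherwise \<open>0 \<le> \<beta> \<le> w\<close>, and in the time \<open>ds = dt / (u 1 * u h)\<close>,
  which runs to infinity, \<open>\<beta>' = \<beta> * (w - \<beta>) - F\<close> with \<open>F = \<kappa> * rho * (u 1 * u h)\<^sup>2\<close>, which behaves
  like \<open>u 1 ^ (2 - J) * u h ^ (2 - (n - J))\<close> and, \<open>\<beta>\<close> being bounded, cannot tend to infinity. If
  \<open>J \<le> 2\<close> then \<open>F\<close> has a limit or tends to infinity, so it has a limit and \<open>\<beta>\<close> converges; if \<open>J \<ge> 3\<close>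
  and \<open>n \<le> 2 * J\<close> then \<open>F\<close> would tend to infinity; and in the remaining case \<open>(\<beta>, F)\<close> is an
  asymptotically autonomous planar system with a Lyapunov function. Finally \<open>u 1 * u h \<longlongrightarrow> 0\<close> has
  derivative close to \<open>w - 2 * \<beta>\<close>, so the limit of \<open>\<beta>\<close> is at least \<open>w / 2\<close>.
\<close>

section \<open>Derivatives, monotonicity and limits\<close>

lemma lift_Suc_mono_le_on:
  fixes f :: "nat \<Rightarrow> 'a :: preorder"
  assumes Suc_le: "\<And>i. a \<le> i \<Longrightarrow> i < b \<Longrightarrow> f i \<le> f (Suc i)" and "a \<le> i" "i \<le> b"
  shows "f a \<le> f i"
  using \<open>a \<le> i\<close> \<open>i \<le> b\<close>
proof (induction i rule: dec_induct)
  case (step i)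
  then show ?case using Suc_le[of i] order_trans by fastforce
qed simp

lemma deriv_ge_imp_diff_ge:
  fixes f :: "real \<Rightarrow> real"
  assumes "x \<le> y" "{x..y} \<subseteq> S"
    and der: "\<And>t. t \<in> {x..y} \<Longrightarrow> (f has_real_derivative f' t) (at t within S)"
    and ge: "\<And>t. t \<in> {x..y} \<Longrightarrow> C \<le> f' t"
  shows "C * (y - x) \<le> f y - f x"
proof (cases "x = y")
  case False
  then have "x < y" using assms by simp
  obtain z where z: "z \<in> {x<..<y}" "f y - f x = f' z * (y - x)"
    using mvt_simple[OF \<open>x < y\<close>, of f "\<lambda>t. (*) (f' t)"] has_field_derivative_subset[OF der assms(2)]
    by (auto simp: has_field_derivative_def)
  then show ?thesis using ge[of z] \<open>x < y\<close> by (auto intro!: mult_right_mono)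
qed simp

lemma deriv_nonneg_imp_le:
  fixes f :: "real \<Rightarrow> real"
  assumes "x \<le> y" "{x..y} \<subseteq> S"
    and "\<And>t. t \<in> {x..y} \<Longrightarrow> (f has_real_derivative f' t) (at t within S)"
    and "\<And>t. t \<in> {x..y} \<Longrightarrow> 0 \<le> f' t"
  shows "f x \<le> f y"
  using deriv_ge_imp_diff_ge[of x y S f f' 0] assms by simp

lemma deriv_nonpos_imp_ge:
  fixes f :: "real \<Rightarrow> real"
  assumes "x \<le> y" "{x..y} \<subseteq> S"
    and "\<And>t. t \<in> {x..y} \<Longrightarrow> (f has_real_derivative f' t) (at t within S)"
    and "\<And>t. t \<in> {x..y} \<Longrightarrow> f' t \<le> 0"
  shows "f y \<le> f x"
  using deriv_nonneg_imp_le[of x y S "\<lambda>t. - f t" "\<lambda>t. - f' t"] assms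
  by (auto intro: DERIV_minus)

lemma deriv_zero_imp_eq:
  fixes f :: "real \<Rightarrow> real"
  assumes "x \<le> y" "{x..y} \<subseteq> S"
    and "\<And>t. t \<in> {x..y} \<Longrightarrow> (f has_real_derivative 0) (at t within S)"
  shows "f x = f y"
  using deriv_nonneg_imp_le[OF assms] deriv_nonpos_imp_ge[OF assms] by simp

lemma deriv_bounded_below_imp_bdd_below:
  fixes f :: "real \<Rightarrow> real"
  assumes der: "\<And>t. t \<in> {a..<b} \<Longrightarrow> (f has_real_derivative f' t) (at t within {a..<b})"
    and ge: "\<And>t. t \<in> {a..<b} \<Longrightarrow> C \<le> f' t"
  shows "bdd_below (f ` {a..<b})"
proof (rule bdd_belowI2)
  fix t assume t: "t \<in> {a..<b}"
  have "\<bar>C\<bar> * (t - a) \<le> \<bar>C\<bar> * (b - a)" using t by (intro mult_left_mono) auto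
  moreover have "- \<bar>C\<bar> * (t - a) \<le> f t - f a"
  proof (rule deriv_ge_imp_diff_ge[of _ _ "{a..<b}" f f'])
    show "- \<bar>C\<bar> \<le> f' s" if "s \<in> {a..t}" for s using ge[of s] that t by auto
  qed (use t in \<open>auto intro: der\<close>)
  ultimately show "f a - \<bar>C\<bar> * (b - a) \<le> f t" by simp
qed

lemma deriv_bounded_above_imp_bdd_above:
  fixes f :: "real \<Rightarrow> real"
  assumes "\<And>t. t \<in> {a..<b} \<Longrightarrow> (f has_real_derivative f' t) (at t within {a..<b})"
    and "\<And>t. t \<in> {a..<b} \<Longrightarrow> f' t \<le> C"
  shows "bdd_above (f ` {a..<b})"
proof -
  have "bdd_below ((\<lambda>t. - f t) ` {a..<b})"
    by (rule deriv_bounded_below_imp_bdd_below[where f' = "\<lambda>t. - f' t" and C = "- C"])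
      (use DERIV_minus[OF assms(1)] assms(2) in simp_all)
  then obtain m where "\<And>t. t \<in> {a..<b} \<Longrightarrow> m \<le> - f t" by (meson bdd_below.E imageI)
  then show ?thesis by (intro bdd_aboveI2[where M = "- m"]) force
qed

lemma bdd_below_above_imp_bounded:
  fixes A :: "real set"
  assumes "bdd_below A" "bdd_above A"
  shows "bounded A"
proof -
  obtain m M where "\<forall>x\<in>A. m \<le> x" "\<forall>x\<in>A. x \<le> M"
    using assms by (auto simp: bdd_below_def bdd_above_def)
  then have "A \<subseteq> {m..M}" by auto
  then show ?thesis using bounded_closed_interval bounded_subset by blast
qed

lemma eventually_in_at_left: "a < b \<Longrightarrow> \<forall>\<^sub>F t in at_left b. t \<in> {a..<b}" for a b :: real
  using eventually_at_left_real by (rule eventually_mono) auto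

lemma filterlim_at_left_transform:
  fixes a b :: real
  assumes "filterlim f F (at_left b)" "a < b" "\<And>t. t \<in> {a..<b} \<Longrightarrow> f t = g t"
  shows "filterlim g F (at_left b)"
proof -
  have "\<forall>\<^sub>F t in at_left b. f t = g t"
    using eventually_in_at_left[OF \<open>a < b\<close>] by eventually_elim (rule assms(3))
  then show ?thesis using filterlim_cong[OF refl refl] assms(1) by blast
qed

lemma mono_on_bdd_above_tendsto_at_left:
  fixes f :: "real \<Rightarrow> real"
  assumes "a < b" "mono_on {a..<b} f" "bdd_above (f ` {a..<b})"
  shows "(f \<longlongrightarrow> (SUP t\<in>{a..<b}. f t)) (at_left b)"
proof -
  have "{..<b} \<inter> {a..} = {a..<b}" by auto
  moreover obtain K where "\<And>t. t \<in> {a..<b} \<Longrightarrow> f t \<le> K" using assms(3) by (meson bdd_above.E imageI)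
  ultimately have "(f \<longlongrightarrow> (SUP t\<in>{a..<b}. f t)) (at b within {a..<b})"
    using Lim_left_bound[of "{a..}" b f K] assms(2) by (auto simp: monotone_on_def)
  moreover have "at b within {a..<b} = at_left b"
    by (rule at_within_nhd[of _ "{a<..}"]) (use assms in auto)
  ultimately show ?thesis by simp
qed

lemma mono_on_not_bdd_above_at_top_at_left:
  fixes f :: "real \<Rightarrow> real"
  assumes mono: "mono_on {a..<b} f" and "\<not> bdd_above (f ` {a..<b})"
  shows "filterlim f at_top (at_left b)"
  unfolding filterlim_at_top
proof
  fix Z
  from assms(2) obtain x where x: "x \<in> {a..<b}" "Z < f x"
    by (force simp: bdd_above_def not_le)
  then have "x < b" by simp
  show "\<forall>\<^sub>F t in at_left b. Z \<le> f t"
    using eventually_in_at_left[OF \<open>x < b\<close>]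
    by eventually_elim (use x mono in \<open>force simp: monotone_on_def\<close>)
qed

text \<open>The bound makes \<open>f t + C * t\<close> nondecreasing and bounded.\<close>

lemma deriv_bounded_tendsto_at_left:
  fixes f :: "real \<Rightarrow> real"
  assumes "a < b"
    and der: "\<And>t. t \<in> {a..<b} \<Longrightarrow> (f has_real_derivative f' t) (at t within {a..<b})"
    and bound: "\<And>t. t \<in> {a..<b} \<Longrightarrow> \<bar>f' t\<bar> \<le> C"
  obtains L where "(f \<longlongrightarrow> L) (at_left b)"
proof -
  have der': "((\<lambda>t. f t + C * t) has_real_derivative f' t + C) (at t within {a..<b})"
    if "t \<in> {a..<b}" for t using der[OF that] by (auto intro!: derivative_eq_intros)
  have nonneg: "0 \<le> f' t + C" "f' t + C \<le> 2 * C" if "t \<in> {a..<b}" for t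
    using bound[OF that] by auto
  have "mono_on {a..<b} (\<lambda>t. f t + C * t)"
  proof (rule monotone_onI)
    fix x y assume "x \<in> {a..<b}" "y \<in> {a..<b}" "x \<le> y"
    then show "f x + C * x \<le> f y + C * y"
      by (intro deriv_nonneg_imp_le[OF _ _ der']) (auto intro: nonneg)
  qed
  moreover have "bdd_above ((\<lambda>t. f t + C * t) ` {a..<b})"
    using der' nonneg(2) by (rule deriv_bounded_above_imp_bdd_above)
  ultimately have "((\<lambda>t. f t + C * t - C * t) \<longlongrightarrow> (SUP t\<in>{a..<b}. f t + C * t) - C * b) (at_left b)"
    by (intro tendsto_diff mono_on_bdd_above_tendsto_at_left \<open>a < b\<close> tendsto_intros)
  then show ?thesis using that by simp
qed

section \<open>Level crossings\<close>

lemma stays_above_level: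
  fixes f :: "real \<Rightarrow> real"
  assumes der: "\<And>s. s \<in> {r..t} \<Longrightarrow> (f has_real_derivative f' s) (at s)"
    and pos: "\<And>s. s \<in> {r..t} \<Longrightarrow> f s = c \<Longrightarrow> 0 < f' s"
    and "c \<le> f r" "r \<le> t"
  shows "c \<le> f t"
proof (rule ccontr)
  assume "\<not> c \<le> f t"
  have cont: "continuous_on {r..t} f"
    by (intro continuous_at_imp_continuous_on ballI DERIV_isCont[OF der])
  define A where "A = {r..t} \<inter> f -` {c..}"
  have "compact A"
    unfolding A_def compact_eq_bounded_closed
    using continuous_closed_preimage[OF cont]
    by (auto intro: bounded_subset[OF bounded_closed_interval])
  moreover have "r \<in> A" using assms by (auto simp: A_def)
  ultimately obtain s where s: "s \<in> A" and s_max: "\<And>x. x \<in> A \<Longrightarrow> x \<le> s"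
    using compact_attains_sup[of A] by blast
  have "r \<le> s" "s < t" "c \<le> f s"
    using s \<open>\<not> c \<le> f t\<close> by (auto simp: A_def less_le)
  moreover have "continuous_on {s..t} f"
    by (rule continuous_on_subset[OF cont]) (use \<open>r \<le> s\<close> in auto)
  ultimately obtain x where "s \<le> x" "x \<le> t" "f x = c"
    using IVT2'[of f t c s] \<open>\<not> c \<le> f t\<close> by auto
  then have "f s = c" using s_max[of x] \<open>r \<le> s\<close> by (auto simp: A_def)
  then obtain d where d: "0 < d" "\<And>h. 0 < h \<Longrightarrow> h < d \<Longrightarrow> f s < f (s + h)"
    using DERIV_pos_inc_right[OF der pos, of s] \<open>r \<le> s\<close> \<open>s < t\<close> by auto
  define h where "h = min (d / 2) (t - s)"
  have "0 < h" "h < d" "h \<le> t - s" using d \<open>s < t\<close> by (auto simp: h_def)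
  then have "s + h \<in> A" using d(2)[of h] \<open>f s = c\<close> \<open>r \<le> s\<close> by (auto simp: A_def)
  then show False using s_max \<open>0 < h\<close> by fastforce
qed

lemma crosses_upwards_imp_eventually_on_one_side:
  fixes f :: "real \<Rightarrow> real"
  assumes "a < b"
    and der: "\<And>t. t \<in> {a..<b} \<Longrightarrow> (f has_real_derivative f' t) (at t)"
    and up: "\<forall>\<^sub>F t in at_left b. f t = c \<longrightarrow> 0 < f' t"
  shows "(\<forall>\<^sub>F t in at_left b. c \<le> f t) \<or> (\<forall>\<^sub>F t in at_left b. f t \<le> c)"
proof -
  obtain d where d: "d < b" "\<And>t. d < t \<Longrightarrow> t < b \<Longrightarrow> f t = c \<Longrightarrow> 0 < f' t"
    using up unfolding eventually_at_left_field by blast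
  define r where "r = max a d"
  have "r < b" using d \<open>a < b\<close> by (simp add: r_def)
  show ?thesis
  proof (cases "\<exists>s\<in>{r<..<b}. c \<le> f s")
    case True
    then obtain s where s: "s \<in> {r<..<b}" "c \<le> f s" by blast
    then have "s < b" by simp
    have "\<forall>\<^sub>F t in at_left b. c \<le> f t"
      using eventually_in_at_left[OF \<open>s < b\<close>]
    proof eventually_elim
      case (elim t)
      show ?case
        by (rule stays_above_level[of s t f f']) (use s elim d in \<open>auto simp: r_def intro: der\<close>)
    qed
    then show ?thesis ..
  next
    case False
    have "\<forall>\<^sub>F t in at_left b. f t \<le> c"
      using eventually_at_left_real[OF \<open>r < b\<close>] by eventually_elim (use False in force)
    then show ?thesis ..
  qed
qed

lemma bounded_convergent_if_eventually_on_one_side: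
  fixes f :: "'a \<Rightarrow> real"
  assumes "G \<noteq> bot" "finite Z"
    and bnd: "\<forall>\<^sub>F x in G. f x \<in> {A..B}"
    and side: "\<And>c. c \<notin> Z \<Longrightarrow> c \<in> {A<..<B} \<Longrightarrow>
      (\<forall>\<^sub>F x in G. c \<le> f x) \<or> (\<forall>\<^sub>F x in G. f x \<le> c)"
  obtains L where "(f \<longlongrightarrow> L) G" "L \<in> {A..B}"
proof
  define S where "S = {c. \<forall>\<^sub>F x in G. c \<le> f x}"
  have "A \<in> S" unfolding S_def using bnd by (auto elim: eventually_mono)
  have S_le_B: "c \<le> B" if "c \<in> S" for c
  proof -
    have "\<forall>\<^sub>F x in G. c \<le> f x" using that by (simp add: S_def)
    from eventually_happens'[OF \<open>G \<noteq> bot\<close> eventually_conj[OF this bnd]] show ?thesis by auto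
  qed
  then have bdd: "bdd_above S" by (auto simp: bdd_above_def)
  show "Sup S \<in> {A..B}"
    using cSup_upper[OF \<open>A \<in> S\<close> bdd] cSup_least[of S B] \<open>A \<in> S\<close> S_le_B by auto
  show "(f \<longlongrightarrow> Sup S) G"
  proof (rule order_tendstoI)
    fix y assume "y < Sup S"
    then obtain c where "c \<in> S" "y < c" using less_cSup_iff[OF _ bdd, of y] \<open>A \<in> S\<close> by auto
    then show "\<forall>\<^sub>F x in G. y < f x" by (auto simp: S_def elim!: eventually_mono)
  next
    fix y assume "Sup S < y"
    then have "infinite ({Sup S<..<y} - Z)" using \<open>finite Z\<close> by (simp add: infinite_Ioo)
    then have "{Sup S<..<y} - Z \<noteq> {}" by (rule infinite_imp_nonempty)
    then obtain c where "c \<in> {Sup S<..<y} - Z" by blast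
    then have c: "Sup S < c" "c < y" "c \<notin> Z" by auto
    have "A < c" using cSup_upper[OF \<open>A \<in> S\<close> bdd] c by simp
    have not_above: "\<not> (\<forall>\<^sub>F x in G. c \<le> f x)"
      using cSup_upper[OF _ bdd, of c] c by (auto simp: S_def)
    have "\<forall>\<^sub>F x in G. f x \<le> c"
    proof (cases "c < B")
      case True
      then show ?thesis using side[OF c(3)] \<open>A < c\<close> not_above by simp
    next
      case False
      show ?thesis using bnd by eventually_elim (use False in auto)
    qed
    then show "\<forall>\<^sub>F x in G. f x < y" by eventually_elim (use c in auto)
  qed
qed

lemma transversal_convergent:
  fixes f :: "real \<Rightarrow> real"
  assumes "a < b" "finite Z"
    and der: "\<And>t. t \<in> {a..<b} \<Longrightarrow> (f has_real_derivative f' t) (at t)"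
    and bnd: "\<And>t. t \<in> {a..<b} \<Longrightarrow> f t \<in> {A..B}"
    and trans: "\<And>c. c \<notin> Z \<Longrightarrow> c \<in> {A<..<B} \<Longrightarrow>
      (\<forall>\<^sub>F t in at_left b. f t = c \<longrightarrow> 0 < f' t) \<or> (\<forall>\<^sub>F t in at_left b. f t = c \<longrightarrow> f' t < 0)"
  obtains L where "(f \<longlongrightarrow> L) (at_left b)" "L \<in> {A..B}"
proof (rule bounded_convergent_if_eventually_on_one_side[OF _ \<open>finite Z\<close>])
  show "\<forall>\<^sub>F t in at_left b. f t \<in> {A..B}"
    using eventually_in_at_left[OF \<open>a < b\<close>] by eventually_elim (rule bnd)
  fix c assume "c \<notin> Z" "c \<in> {A<..<B}"
  then consider (upwards) "\<forall>\<^sub>F t in at_left b. f t = c \<longrightarrow> 0 < f' t"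
    | (downwards) "\<forall>\<^sub>F t in at_left b. - f t = - c \<longrightarrow> 0 < - f' t"
    using trans by auto
  then show "(\<forall>\<^sub>F t in at_left b. c \<le> f t) \<or> (\<forall>\<^sub>F t in at_left b. f t \<le> c)"
  proof cases
    case upwards
    then show ?thesis using crosses_upwards_imp_eventually_on_one_side[OF \<open>a < b\<close> der] by blast
  next
    case downwards
    then have "(\<forall>\<^sub>F t in at_left b. - c \<le> - f t) \<or> (\<forall>\<^sub>F t in at_left b. - f t \<le> - c)"
      by (intro crosses_upwards_imp_eventually_on_one_side[OF \<open>a < b\<close> DERIV_minus[OF der]])
    then show ?thesis by auto
  qed
qed (use that in simp_all)

section \<open>Local solutions of quadratic systems\<close>

definition quadratic_field ::
    "('i \<Rightarrow> 'i \<Rightarrow> 'i \<Rightarrow> real) \<Rightarrow> 'i set \<Rightarrow> ('i \<Rightarrow> real) \<Rightarrow> 'i \<Rightarrow> real" where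
  "quadratic_field b I x i = (\<Sum>p\<in>I. \<Sum>q\<in>I. b i p q * (x p * x q))"

fun quadratic_coeff :: "('i \<Rightarrow> 'i \<Rightarrow> 'i \<Rightarrow> real) \<Rightarrow> 'i set \<Rightarrow> ('i \<Rightarrow> real) \<Rightarrow> nat \<Rightarrow> 'i \<Rightarrow> real" where
  "quadratic_coeff b I x0 0 i = x0 i"
| "quadratic_coeff b I x0 (Suc m) i =
    (\<Sum>p\<in>I. \<Sum>q\<in>I. b i p q *
      (\<Sum>l\<le>m. quadratic_coeff b I x0 l p * quadratic_coeff b I x0 (m - l) q)) / real (Suc m)"

lemma Cauchy_product_geometric_bound:
  fixes f g :: "nat \<Rightarrow> real"
  assumes f: "\<And>l. l \<le> k \<Longrightarrow> \<bar>f l\<bar> \<le> M * R ^ l" and g: "\<And>l. l \<le> k \<Longrightarrow> \<bar>g l\<bar> \<le> M * R ^ l"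
    and "0 \<le> M" "0 \<le> R"
  shows "\<bar>\<Sum>l\<le>k. f l * g (k - l)\<bar> \<le> real (Suc k) * (M * M * R ^ k)"
proof -
  have "\<bar>\<Sum>l\<le>k. f l * g (k - l)\<bar> \<le> (\<Sum>l\<le>k. M * R ^ l * (M * R ^ (k - l)))"
  proof (rule order_trans[OF sum_abs sum_mono])
    fix l assume "l \<in> {..k}"
    then show "\<bar>f l * g (k - l)\<bar> \<le> M * R ^ l * (M * R ^ (k - l))"
      unfolding abs_mult using f g \<open>0 \<le> M\<close> \<open>0 \<le> R\<close> by (intro mult_mono) auto
  qed
  also have "\<dots> = (\<Sum>l\<le>k. M * M * R ^ k)"
    by (intro sum.cong refl) (simp add: mult_ac flip: power_add)
  finally show ?thesis by simp
qed

lemma quadratic_coeff_bound: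
  assumes x0: "\<And>i. i \<in> I \<Longrightarrow> \<bar>x0 i\<bar> \<le> M"
    and b: "\<And>i. i \<in> I \<Longrightarrow> (\<Sum>p\<in>I. \<Sum>q\<in>I. \<bar>b i p q\<bar>) \<le> C"
    and "0 \<le> M" "0 \<le> C" "i \<in> I"
  shows "\<bar>quadratic_coeff b I x0 m i\<bar> \<le> M * (C * M) ^ m"
  using \<open>i \<in> I\<close>
proof (induction m arbitrary: i rule: less_induct)
  case (less m)
  show ?case
  proof (cases m)
    case 0
    then show ?thesis using x0 less.prems by simp
  next
    case (Suc k)
    let ?a = "quadratic_coeff b I x0" and ?B = "M * M * (C * M) ^ k"
    have "\<bar>\<Sum>p\<in>I. \<Sum>q\<in>I. b i p q * (\<Sum>l\<le>k. ?a l p * ?a (k - l) q)\<bar>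
        \<le> (\<Sum>p\<in>I. \<Sum>q\<in>I. \<bar>b i p q\<bar> * (real (Suc k) * ?B))"
    proof (rule order_trans[OF sum_abs sum_mono], rule order_trans[OF sum_abs sum_mono])
      fix p q assume "p \<in> I" "q \<in> I"
      then show "\<bar>b i p q * (\<Sum>l\<le>k. ?a l p * ?a (k - l) q)\<bar> \<le> \<bar>b i p q\<bar> * (real (Suc k) * ?B)"
        unfolding abs_mult using less.IH Suc \<open>0 \<le> M\<close> \<open>0 \<le> C\<close>
        by (intro mult_left_mono Cauchy_product_geometric_bound) auto
    qed
    also have "\<dots> \<le> C * (real (Suc k) * ?B)"
      unfolding sum_distrib_right[symmetric]
      using b[OF less.prems] \<open>0 \<le> M\<close> \<open>0 \<le> C\<close> by (intro mult_right_mono) auto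
    finally show ?thesis
      using Suc by (simp add: field_simps del: of_nat_Suc)
  qed
qed

lemma fps_conv_radius_geI_geometric:
  assumes "\<And>m. \<bar>fps_nth f m\<bar> \<le> M * R ^ m" "0 < R"
  shows "ereal (1 / R) \<le> fps_conv_radius (f :: real fps)"
  unfolding fps_conv_radius_def
proof (rule conv_radius_geI_ex')
  fix r assume r: "0 < r" "ereal r < ereal (1 / R)"
  show "summable (\<lambda>m. fps_nth f m * of_real r ^ m)"
  proof (rule summable_comparison_test_ev)
    show "\<forall>\<^sub>F m in sequentially. norm (fps_nth f m * of_real r ^ m) \<le> M * (R * r) ^ m"
    proof (intro always_eventually allI)
      fix m
      have "\<bar>fps_nth f m\<bar> * r ^ m \<le> M * R ^ m * r ^ m" using assms r by (intro mult_right_mono) auto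
      then show "norm (fps_nth f m * of_real r ^ m) \<le> M * (R * r) ^ m"
        using r by (simp add: abs_mult power_mult_distrib mult_ac)
    qed
    have "R * r < 1" using r \<open>0 < R\<close> by (simp add: field_simps)
    then show "summable (\<lambda>m. M * (R * r) ^ m)"
      using r \<open>0 < R\<close> by (intro summable_mult summable_geometric) simp
  qed
qed

lemma formal_solution_eval_fps:
  fixes A :: "'i \<Rightarrow> real fps"
  assumes deriv_A: "\<And>m. fps_nth (fps_deriv (A i)) m = (\<Sum>p\<in>I. \<Sum>q\<in>I. b i p q * fps_nth (A p * A q) m)"
    and radius: "\<And>i. i \<in> I \<Longrightarrow> ereal \<bar>t\<bar> < fps_conv_radius (A i)" and i: "i \<in> I"
  shows "(eval_fps (A i) has_real_derivative quadratic_field b I (\<lambda>p. eval_fps (A p) t) i) (at t)"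
proof -
  have "(\<lambda>m. fps_nth (A p * A q) m * t ^ m) sums (eval_fps (A p) t * eval_fps (A q) t)"
    if "p \<in> I" "q \<in> I" for p q
  proof -
    have "norm t < fps_conv_radius (A p * A q)"
      using radius that by (intro less_le_trans[OF _ fps_conv_radius_mult]) simp
    from sums_eval_fps[OF this] show ?thesis using radius that by (simp add: eval_fps_mult)
  qed
  then have "(\<lambda>m. \<Sum>p\<in>I. \<Sum>q\<in>I. b i p q * (fps_nth (A p * A q) m * t ^ m)) sums
      quadratic_field b I (\<lambda>p. eval_fps (A p) t) i"
    unfolding quadratic_field_def by (intro sums_sum sums_mult)
  then have "(\<lambda>m. fps_nth (fps_deriv (A i)) m * t ^ m) sums
      quadratic_field b I (\<lambda>p. eval_fps (A p) t) i"
    unfolding deriv_A sum_distrib_right mult.assoc .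
  from sums_unique[OF this] show ?thesis
    using has_field_derivative_eval_fps[of t "A i" UNIV] radius[OF i] by (simp add: eval_fps_def)
qed

lemma quadratic_system_local_solution:
  fixes b :: "'i \<Rightarrow> 'i \<Rightarrow> 'i \<Rightarrow> real"
  assumes "finite I"
  obtains e X where "0 < e" "\<And>i. X i 0 = x0 i"
    and "\<And>i t. i \<in> I \<Longrightarrow> \<bar>t\<bar> < e \<Longrightarrow>
      (X i has_real_derivative quadratic_field b I (\<lambda>p. X p t) i) (at t)"
proof -
  define M where "M = Max (insert 1 ((\<lambda>i. \<bar>x0 i\<bar>) ` I))"
  define C where "C = Max (insert 1 ((\<lambda>i. \<Sum>p\<in>I. \<Sum>q\<in>I. \<bar>b i p q\<bar>) ` I))"
  have M: "1 \<le> M" "\<And>i. i \<in> I \<Longrightarrow> \<bar>x0 i\<bar> \<le> M"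
    and C: "1 \<le> C" "\<And>i. i \<in> I \<Longrightarrow> (\<Sum>p\<in>I. \<Sum>q\<in>I. \<bar>b i p q\<bar>) \<le> C"
    unfolding M_def C_def by (rule Max_ge; use \<open>finite I\<close> in simp)+
  define A where "A i = Abs_fps (\<lambda>m. quadratic_coeff b I x0 m i)" for i
  define e where "e = 1 / (C * M)"
  have radius: "ereal \<bar>t\<bar> < fps_conv_radius (A i)" if "i \<in> I" "\<bar>t\<bar> < e" for i t
  proof -
    have "ereal e \<le> fps_conv_radius (A i)"
      unfolding e_def A_def using quadratic_coeff_bound[OF M(2) C(2)] M(1) C(1) that(1)
      by (intro fps_conv_radius_geI_geometric) auto
    moreover have "ereal \<bar>t\<bar> < ereal e" using that by simp
    ultimately show ?thesis by (rule less_le_trans[rotated])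
  qed
  have deriv_A: "fps_nth (fps_deriv (A i)) m =
      (\<Sum>p\<in>I. \<Sum>q\<in>I. b i p q * fps_nth (A p * A q) m)" for i m
    by (simp add: A_def fps_mult_nth atLeast0AtMost del: of_nat_Suc)
  have "(eval_fps (A i) has_real_derivative quadratic_field b I (\<lambda>p. eval_fps (A p) t) i) (at t)"
    if "i \<in> I" "\<bar>t\<bar> < e" for i t
    using deriv_A radius[OF _ that(2)] that(1) by (rule formal_solution_eval_fps)
  moreover have "eval_fps (A i) 0 = x0 i" for i by (simp add: eval_fps_at_0 A_def)
  moreover have "0 < e" using M(1) C(1) by (simp add: e_def)
  ultimately show ?thesis by (intro that[of e "\<lambda>i. eval_fps (A i)"])
qed

text \<open>Index \<open>0\<close> stands for the density, the indices \<open>1..n\<close> for the eigenvalues; the constant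
  component with index \<open>n + 1\<close> makes the system homogeneous.\<close>

definition flow_form :: "nat \<Rightarrow> real \<Rightarrow> real \<Rightarrow> nat \<Rightarrow> nat \<Rightarrow> nat \<Rightarrow> real" where
  "flow_form n \<kappa> c i p q =
    (if i = 0 then - of_bool (p = 0 \<and> q \<in> {1..n})
     else if i \<le> n then - of_bool (p = i \<and> q = i) + \<kappa> * of_bool (p = 0 \<and> q = Suc n)
       - \<kappa> * c * of_bool (p = Suc n \<and> q = Suc n)
     else 0)"

lemma sum_sum_of_bool_eq:
  fixes f :: "'a \<Rightarrow> 'b \<Rightarrow> real"
  assumes "finite A" "finite B" "a \<in> A" "B' \<subseteq> B"
  shows "(\<Sum>p\<in>A. \<Sum>q\<in>B. of_bool (p = a \<and> q \<in> B') * f p q) = (\<Sum>q\<in>B'. f a q)"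
proof -
  have "(\<Sum>q\<in>B. of_bool (p = a \<and> q \<in> B') * f p q) = (if p = a then \<Sum>q\<in>B'. f a q else 0)" for p
    using assms by (auto simp: sum.If_cases of_bool_def if_distrib Int_absorb1
        intro!: sum.mono_neutral_cong_right)
  then show ?thesis using assms by simp
qed

lemma quadratic_field_flow_form:
  fixes x :: "nat \<Rightarrow> real"
  shows "quadratic_field (flow_form n \<kappa> c) {..Suc n} x 0 = - x 0 * (\<Sum>i=1..n. x i)"
    and "i \<in> {1..n} \<Longrightarrow> quadratic_field (flow_form n \<kappa> c) {..Suc n} x i =
      - (x i)\<^sup>2 + \<kappa> * (x 0 * x (Suc n) - c * (x (Suc n))\<^sup>2)"
    and "quadratic_field (flow_form n \<kappa> c) {..Suc n} x (Suc n) = 0"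
proof -
  let ?S = "quadratic_field (flow_form n \<kappa> c) {..Suc n} x"
  let ?\<delta> = "\<lambda>a B. \<Sum>p\<le>Suc n. \<Sum>q\<le>Suc n. of_bool (p = a \<and> q \<in> B) * (x p * x q)"
  have \<delta>: "?\<delta> a B = x a * (\<Sum>q\<in>B. x q)" if "a \<le> Suc n" "B \<subseteq> {..Suc n}" for a B
    by (subst sum_sum_of_bool_eq) (use that in \<open>auto simp: sum_distrib_left\<close>)
  have "?S 0 = - ?\<delta> 0 {1..n}"
    by (simp add: quadratic_field_def flow_form_def sum_negf del: sum.atMost_Suc)
  also have "\<dots> = - x 0 * (\<Sum>i=1..n. x i)" by (subst \<delta>) auto
  finally show "?S 0 = - x 0 * (\<Sum>i=1..n. x i)" .
  show "?S i = - (x i)\<^sup>2 + \<kappa> * (x 0 * x (Suc n) - c * (x (Suc n))\<^sup>2)" if "i \<in> {1..n}"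
  proof -
    have "?S i = - ?\<delta> i {i} + \<kappa> * ?\<delta> 0 {Suc n} - \<kappa> * c * ?\<delta> (Suc n) {Suc n}"
      using that
      by (simp add: quadratic_field_def flow_form_def sum_negf sum.distrib sum_subtractf
          sum_distrib_left algebra_simps del: sum.atMost_Suc)
    also have "\<dots> = - (x i)\<^sup>2 + \<kappa> * (x 0 * x (Suc n) - c * (x (Suc n))\<^sup>2)"
      using \<delta>[of i "{i}"] \<delta>[of 0 "{Suc n}"] \<delta>[of "Suc n" "{Suc n}"] that
      by (simp add: power2_eq_square algebra_simps del: sum.atMost_Suc)
    finally show ?thesis .
  qed
qed (simp add: quadratic_field_def flow_form_def)

lemma flow_local_solution:
  fixes n :: nat
  obtains e L r where "0 < e" "r 0 = r0" "\<And>i. i \<in> {1..n} \<Longrightarrow> L i 0 = L0 i"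
    and "\<And>t. \<bar>t\<bar> < e \<Longrightarrow> (r has_real_derivative - r t * (\<Sum>i=1..n. L i t)) (at t)"
    and "\<And>i t. i \<in> {1..n} \<Longrightarrow> \<bar>t\<bar> < e \<Longrightarrow>
      (L i has_real_derivative - (L i t)\<^sup>2 + \<kappa> * (r t - c)) (at t)"
proof -
  define x0 where "x0 i = (if i = 0 then r0 else if i = Suc n then 1 else L0 i)" for i
  obtain e X where e: "0 < e" and X0: "\<And>i. X i 0 = x0 i"
    and der_X: "\<And>i t. i \<in> {..Suc n} \<Longrightarrow> \<bar>t\<bar> < e \<Longrightarrow> 
      (X i has_real_derivative quadratic_field (flow_form n \<kappa> c) {..Suc n} (\<lambda>p. X p t) i) (at t)"
    using quadratic_system_local_solution[of "{..Suc n}" x0 "flow_form n \<kappa> c"] by blast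
  have X1: "X (Suc n) t = 1" if "\<bar>t\<bar> < e" for t
  proof -
    have "X (Suc n) t = X (Suc n) 0"
      by (rule DERIV_isconst3[of "- e" e])
        (use e that der_X[of "Suc n"] quadratic_field_flow_form(3)[of n \<kappa> c] in auto)
    then show ?thesis by (simp add: X0 x0_def)
  qed
  show ?thesis
  proof (rule that[of e "X 0" X, OF e])
    fix t :: real assume t: "\<bar>t\<bar> < e"
    show "(X 0 has_real_derivative - X 0 t * (\<Sum>i=1..n. X i t)) (at t)"
      using der_X[of 0, OF _ t] by (simp only: quadratic_field_flow_form(1)) simp
    show "(X i has_real_derivative - (X i t)\<^sup>2 + \<kappa> * (X 0 t - c)) (at t)" if "i \<in> {1..n}" for i
      using der_X[of i, OF _ t] that
      by (simp only: quadratic_field_flow_form(2)[OF that] X1[OF t]) simp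
  qed (auto simp: X0 x0_def)
qed

section \<open>Continuation of bounded solutions\<close>

lemma has_real_derivative_at_left_of_deriv_tendsto:
  fixes f :: "real \<Rightarrow> real"
  assumes "(f \<longlongrightarrow> f x) (at_left x)" "\<forall>\<^sub>F y in at_left x. (f has_real_derivative f' y) (at y)"
    and "(f' \<longlongrightarrow> D) (at_left x)"
  shows "(f has_real_derivative D) (at_left x)"
  unfolding has_field_derivative_iff
proof (rule lhopital_left[where f' = f' and g' = "\<lambda>_. 1"])
  show "((\<lambda>y. f y - f x) \<longlongrightarrow> 0) (at_left x)" using assms(1) by (simp add: LIM_zero)
  show "((\<lambda>y. y - x) \<longlongrightarrow> 0) (at_left x)" by (simp add: LIM_zero)
  show "\<forall>\<^sub>F y in at_left x. y - x \<noteq> 0" by (auto simp: eventually_at_filter)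
  show "\<forall>\<^sub>F y in at_left x. ((\<lambda>y. f y - f x) has_real_derivative f' y) (at y)"
    using assms(2) by eventually_elim (auto intro!: derivative_eq_intros)
  show "\<forall>\<^sub>F y in at_left x. ((\<lambda>y. y - x) has_real_derivative 1) (at y)"
    by (auto intro!: always_eventually derivative_eq_intros)
qed (use assms(3) in simp_all)

lemma has_real_derivative_at_left_right:
  fixes f :: "real \<Rightarrow> real"
  assumes "(f has_real_derivative D) (at_left x)" "(f has_real_derivative D) (at_right x)"
  shows "(f has_real_derivative D) (at x)"
  using assms unfolding has_field_derivative_iff by (rule filterlim_split_at)

lemma has_real_derivative_glue_at:
  fixes f g :: "real \<Rightarrow> real"
  assumes "a < T"
    and der_f: "\<And>t. t \<in> {a..<T} \<Longrightarrow> (f has_real_derivative f' t) (at t within {a..<T})"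
    and der_g: "(g has_real_derivative D) (at T)"
    and f_lim: "(f \<longlongrightarrow> g T) (at_left T)" and f'_lim: "(f' \<longlongrightarrow> D) (at_left T)"
  shows "((\<lambda>t. if t < T then f t else g t) has_real_derivative D) (at T)"
proof (rule has_real_derivative_at_left_right)
  let ?h = "\<lambda>t. if t < T then f t else g t"
  show "(?h has_real_derivative D) (at_left T)"
  proof (rule has_real_derivative_at_left_of_deriv_tendsto[OF _ _ f'_lim])
    show "\<forall>\<^sub>F y in at_left T. (?h has_real_derivative f' y) (at y)"
      using eventually_at_left_real[OF \<open>a < T\<close>]
    proof eventually_elim
      case (elim y)
      then have "(f has_real_derivative f' y) (at y)"
        using der_f[of y] at_within_interior[of y "{a..<T}"] by simp
      then show ?case
        by (rule has_field_derivative_transform_within_open[where S = "{..<T}"]) (use elim in auto)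
    qed
    show "(?h \<longlongrightarrow> ?h T) (at_left T)"
      by (rule Lim_transform_eventually[where f = f])
        (use f_lim in \<open>auto simp: eventually_at_filter\<close>)
  qed
  have "(g has_real_derivative D) (at T within {T..})"
    using der_g by (rule has_field_derivative_at_within)
  then have "(?h has_real_derivative D) (at T within {T..})"
    by (rule has_field_derivative_transform_within[OF _ zero_less_one]) auto
  then show "(?h has_real_derivative D) (at_right T)" by (simp add: at_within_Ici_at_right)
qed

lemma has_real_derivative_glue:
  fixes f g :: "real \<Rightarrow> real"
  assumes "a < T"
    and der_f: "\<And>t. t \<in> {a..<T} \<Longrightarrow> (f has_real_derivative f' t) (at t within {a..<T})"
    and der_g: "\<And>t. t \<in> {T..<b} \<Longrightarrow> (g has_real_derivative g' t) (at t)"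
    and f_lim: "(f \<longlongrightarrow> g T) (at_left T)" and f'_lim: "(f' \<longlongrightarrow> g' T) (at_left T)"
    and t: "t \<in> {a..<b}"
  shows "((\<lambda>t. if t < T then f t else g t) has_real_derivative (if t < T then f' t else g' t))
    (at t within {a..<b})"
proof -
  let ?h = "\<lambda>t. if t < T then f t else g t"
  consider (before) "t < T" | (after) "T < t" | (at) "t = T" by linarith
  then show ?thesis
  proof cases
    case before
    have "at t within {a..<b} = at t within {a..<T}"
      by (rule at_within_nhd[of _ "{..<min T b}"]) (use before t in auto)
    moreover have "(?h has_real_derivative f' t) (at t within {a..<T})"
      by (rule has_field_derivative_transform_within[OF der_f zero_less_one]) (use t before in auto)
    ultimately show ?thesis using before by simp
  next
    case after
    have "(?h has_real_derivative g' t) (at t)"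
      by (rule has_field_derivative_transform_within_open[OF der_g, where S = "{T<..}"])
        (use after t in auto)
    then show ?thesis using after by (auto intro: has_field_derivative_at_within)
  next
    case at
    have "(?h has_real_derivative g' T) (at T)"
      using \<open>a < T\<close> der_f _ f_lim f'_lim
      by (rule has_real_derivative_glue_at) (use der_g[of T] at t in auto)
    then show ?thesis using at by (auto intro: has_field_derivative_at_within)
  qed
qed

lemma bounded_solution_tendsto:
  assumes sol: "is_solution n k cb rho0 lam0 T lam rho"
    and lam_bounded: "\<And>i. i \<in> {1..n} \<Longrightarrow> bounded (lam i ` {0..<T})"
    and rho_bounded: "bounded (rho ` {0..<T})"
  obtains L r where "\<And>i. i \<in> {1..n} \<Longrightarrow> (lam i \<longlongrightarrow> L i) (at_left T)" "(rho \<longlongrightarrow> r) (at_left T)"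
proof -
  have "0 < T"
    and der_lam: "\<And>i t. i \<in> {1..n} \<Longrightarrow> t \<in> {0..<T} \<Longrightarrow>
      (lam i has_real_derivative - (lam i t)\<^sup>2 + k / real n * (rho t - cb)) (at t within {0..<T})"
    and der_rho: "\<And>t. t \<in> {0..<T} \<Longrightarrow>
      (rho has_real_derivative - rho t * (\<Sum>i=1..n. lam i t)) (at t within {0..<T})"
    using sol by (auto simp: is_solution_def)
  obtain R where R: "\<And>t. t \<in> {0..<T} \<Longrightarrow> \<bar>rho t\<bar> \<le> R"
    using rho_bounded unfolding bounded_iff by fastforce
  obtain B where B: "\<And>i t. i \<in> {1..n} \<Longrightarrow> t \<in> {0..<T} \<Longrightarrow> \<bar>lam i t\<bar> \<le> B i"
    using lam_bounded unfolding bounded_iff ball_simps real_norm_def by metis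
  have lam'_bound: "\<bar>- (lam i t)\<^sup>2 + k / real n * (rho t - cb)\<bar>
      \<le> (B i)\<^sup>2 + \<bar>k / real n\<bar> * (R + \<bar>cb\<bar>)"
    if "i \<in> {1..n}" "t \<in> {0..<T}" for i t
  proof -
    have "\<bar>- (lam i t)\<^sup>2 + k / real n * (rho t - cb)\<bar> \<le> \<bar>lam i t\<bar>\<^sup>2 + \<bar>k / real n\<bar> * \<bar>rho t - cb\<bar>"
      by (rule order_trans[OF abs_triangle_ineq]) (simp add: abs_mult)
    also have "\<dots> \<le> (B i)\<^sup>2 + \<bar>k / real n\<bar> * (R + \<bar>cb\<bar>)"
      using B[OF that] R[OF that(2)] by (intro add_mono power_mono mult_left_mono) auto
    finally show ?thesis .
  qed
  have "\<exists>L. (lam i \<longlongrightarrow> L) (at_left T)" if i: "i \<in> {1..n}" for i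
    using deriv_bounded_tendsto_at_left[OF \<open>0 < T\<close> der_lam[OF i] lam'_bound[OF i]] by blast
  then obtain L where "\<And>i. i \<in> {1..n} \<Longrightarrow> (lam i \<longlongrightarrow> L i) (at_left T)" by metis
  moreover have "\<bar>- rho t * (\<Sum>i=1..n. lam i t)\<bar> \<le> R * (\<Sum>i=1..n. B i)" if t: "t \<in> {0..<T}" for t
  proof -
    have "\<bar>\<Sum>i=1..n. lam i t\<bar> \<le> (\<Sum>i=1..n. B i)"
      by (rule order_trans[OF sum_abs sum_mono]) (use B t in auto)
    then show ?thesis unfolding abs_mult using R[OF t] by (intro mult_mono) auto
  qed
  then obtain r where "(rho \<longlongrightarrow> r) (at_left T)"
    using deriv_bounded_tendsto_at_left[OF \<open>0 < T\<close> der_rho] by blast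
  ultimately show ?thesis using that by blast
qed

lemma is_solution_glue:
  fixes L :: "nat \<Rightarrow> real \<Rightarrow> real" and r :: "real \<Rightarrow> real"
  assumes sol: "is_solution n k cb rho0 lam0 T lam rho" and "0 < e"
    and lam_lim: "\<And>i. i \<in> {1..n} \<Longrightarrow> (lam i \<longlongrightarrow> L i T) (at_left T)"
    and rho_lim: "(rho \<longlongrightarrow> r T) (at_left T)"
    and der_L: "\<And>i t. i \<in> {1..n} \<Longrightarrow> t \<in> {T..<T + e} \<Longrightarrow>
      (L i has_real_derivative - (L i t)\<^sup>2 + k / real n * (r t - cb)) (at t)"
    and der_r: "\<And>t. t \<in> {T..<T + e} \<Longrightarrow> (r has_real_derivative - r t * (\<Sum>i=1..n. L i t)) (at t)"
  shows "is_solution n k cb rho0 lam0 (T + e)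
    (\<lambda>i t. if t < T then lam i t else L i t) (\<lambda>t. if t < T then rho t else r t)"
proof -
  let ?lam = "\<lambda>i t. if t < T then lam i t else L i t" and ?rho = "\<lambda>t. if t < T then rho t else r t"
  have T: "0 < T" using sol by (simp add: is_solution_def)
  have "(?rho has_real_derivative - ?rho t * (\<Sum>i=1..n. ?lam i t)) (at t within {0..<T + e})"
    if t: "t \<in> {0..<T + e}" for t
  proof (rule DERIV_cong[OF has_real_derivative_glue[OF T _ der_r rho_lim _ t]])
    show "((\<lambda>t. - rho t * (\<Sum>i=1..n. lam i t)) \<longlongrightarrow> - r T * (\<Sum>i=1..n. L i T)) (at_left T)"
      by (intro tendsto_intros rho_lim lam_lim)
  qed (use sol in \<open>auto simp: is_solution_def\<close>)
  moreover have "(?lam i has_real_derivative - (?lam i t)\<^sup>2 + k / real n * (?rho t - cb))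
      (at t within {0..<T + e})" if i: "i \<in> {1..n}" and t: "t \<in> {0..<T + e}" for i t
  proof (rule DERIV_cong[OF has_real_derivative_glue[OF T _ der_L[OF i] lam_lim[OF i] _ t]])
    show "((\<lambda>t. - (lam i t)\<^sup>2 + k / real n * (rho t - cb)) \<longlongrightarrow>
        - (L i T)\<^sup>2 + k / real n * (r T - cb)) (at_left T)"
      by (intro tendsto_intros rho_lim lam_lim i)
  qed (use sol i in \<open>auto simp: is_solution_def\<close>)
  ultimately show ?thesis using sol \<open>0 < e\<close> by (simp add: is_solution_def)
qed

lemma bounded_solution_extends:
  assumes sol: "is_solution n k cb rho0 lam0 T lam rho"
    and bounded: "\<And>i. i \<in> {1..n} \<Longrightarrow> bounded (lam i ` {0..<T})" "bounded (rho ` {0..<T})"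
  shows "\<exists>T' lam' rho'. T' > T \<and> is_solution n k cb rho0 lam0 T' lam' rho' \<and>
    (\<forall>t\<in>{0..<T}. rho' t = rho t \<and> (\<forall>i\<in>{1..n}. lam' i t = lam i t))"
proof -
  obtain L0 r0 where lam_lim: "\<And>i. i \<in> {1..n} \<Longrightarrow> (lam i \<longlongrightarrow> L0 i) (at_left T)"
    and rho_lim: "(rho \<longlongrightarrow> r0) (at_left T)"
    using bounded_solution_tendsto[OF assms] by blast
  obtain e L r where e: "0 < e" and init: "r 0 = r0" "\<And>i. i \<in> {1..n} \<Longrightarrow> L i 0 = L0 i"
    and der_r: "\<And>t. \<bar>t\<bar> < e \<Longrightarrow> (r has_real_derivative - r t * (\<Sum>i=1..n. L i t)) (at t)"
    and der_L: "\<And>i t. i \<in> {1..n} \<Longrightarrow> \<bar>t\<bar> < e \<Longrightarrow>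
      (L i has_real_derivative - (L i t)\<^sup>2 + k / real n * (r t - cb)) (at t)"
    using flow_local_solution[of r0 n L0 "k / real n" cb] by blast
  have "is_solution n k cb rho0 lam0 (T + e) (\<lambda>i t. if t < T then lam i t else L i (t - T))
      (\<lambda>t. if t < T then rho t else r (t - T))"
    using sol e
  proof (rule is_solution_glue)
    fix t assume "t \<in> {T..<T + e}"
    then have t: "\<bar>t - T\<bar> < e" by auto
    show "((\<lambda>t. r (t - T)) has_real_derivative - r (t - T) * (\<Sum>i=1..n. L i (t - T))) (at t)"
      using DERIV_shift[of r _ t "- T"] der_r[OF t] by simp
    show "((\<lambda>t. L i (t - T)) has_real_derivative
        - (L i (t - T))\<^sup>2 + k / real n * (r (t - T) - cb)) (at t)"
      if "i \<in> {1..n}" for i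
      using DERIV_shift[of "L i" _ t "- T"] der_L[OF that t] by simp
  qed (use lam_lim rho_lim init in simp_all)
  then show ?thesis using e by (intro exI[of _ "T + e"] exI conjI[OF _ conjI]) auto
qed

section \<open>The forced logistic equation\<close>

locale diverging_clock =
  fixes a b :: real and \<tau> \<gamma> :: "real \<Rightarrow> real"
  assumes a_less_b: "a < b"
    and der_clock: "\<And>t. t \<in> {a..<b} \<Longrightarrow> (\<tau> has_real_derivative \<gamma> t) (at t)"
    and speed_pos: "\<And>t. t \<in> {a..<b} \<Longrightarrow> 0 < \<gamma> t"
    and clock_at_top: "filterlim \<tau> at_top (at_left b)"
begin

lemma deriv_ge_speed_imp_diff_ge_clock:
  fixes f :: "real \<Rightarrow> real"
  assumes "{s..t} \<subseteq> {a..<b}" "s \<le> t"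
    and der: "\<And>x. x \<in> {s..t} \<Longrightarrow> (f has_real_derivative f' x) (at x)"
    and ge: "\<And>x. x \<in> {s..t} \<Longrightarrow> C * \<gamma> x \<le> f' x"
  shows "C * (\<tau> t - \<tau> s) \<le> f t - f s"
proof -
  have "f s - C * \<tau> s \<le> f t - C * \<tau> t"
  proof (rule deriv_nonneg_imp_le[OF \<open>s \<le> t\<close> subset_UNIV, where f = "\<lambda>x. f x - C * \<tau> x"])
    fix x assume x: "x \<in> {s..t}"
    then show "((\<lambda>x. f x - C * \<tau> x) has_real_derivative f' x - C * \<gamma> x) (at x)"
      using assms(1) by (intro DERIV_diff DERIV_cmult der der_clock) auto
    show "0 \<le> f' x - C * \<gamma> x" using ge[OF x] by simp
  qed
  then show ?thesis by (simp add: right_diff_distrib)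
qed

lemma clock_mono: "{s..t} \<subseteq> {a..<b} \<Longrightarrow> s \<le> t \<Longrightarrow> \<tau> s \<le> \<tau> t"
  by (rule deriv_nonneg_imp_le[of s t UNIV \<tau> \<gamma>]) (auto intro!: der_clock less_imp_le speed_pos)

lemma clock_runs:
  assumes s: "s \<in> {a..<b}" and "0 \<le> h"
  obtains t where "t \<in> {s..<b}" "\<tau> t = \<tau> s + h"
proof -
  have "\<forall>\<^sub>F t in at_left b. \<tau> s + h \<le> \<tau> t" using clock_at_top by (simp add: filterlim_at_top)
  moreover have "\<forall>\<^sub>F t in at_left b. t \<in> {s..<b}" using s by (intro eventually_in_at_left) simp
  ultimately have "\<forall>\<^sub>F t in at_left b. \<tau> s + h \<le> \<tau> t \<and> t \<in> {s..<b}" by (rule eventually_conj)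
  from eventually_happens'[OF _ this] obtain r where r: "\<tau> s + h \<le> \<tau> r" "r \<in> {s..<b}" by auto
  have "continuous_on {s..r} \<tau>"
    by (intro continuous_at_imp_continuous_on ballI DERIV_isCont[OF der_clock]) (use r s in auto)
  then obtain t where "s \<le> t" "t \<le> r" "\<tau> t = \<tau> s + h"
    using IVT'[of \<tau> s "\<tau> s + h" r] r \<open>0 \<le> h\<close> by auto
  then show ?thesis using r by (intro that[of t]) auto
qed

context
  fixes f f' \<Lambda> \<Lambda>' :: "real \<Rightarrow> real" and C :: real
  assumes der_f: "\<And>t. t \<in> {a..<b} \<Longrightarrow> (f has_real_derivative f' t) (at t)"
    and f'_ge: "\<And>t. t \<in> {a..<b} \<Longrightarrow> - C * \<gamma> t \<le> f' t"
    and der_\<Lambda>: "\<And>t. t \<in> {a..<b} \<Longrightarrow> (\<Lambda> has_real_derivative \<Lambda>' t) (at t)"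
    and \<Lambda>'_ge: "\<And>t. t \<in> {a..<b} \<Longrightarrow> \<gamma> t * f t \<le> \<Lambda>' t"
begin

lemma clock_integral_ge:
  assumes st: "{s..t} \<subseteq> {a..<b}" "s \<le> t"
    and f_s: "e \<le> f s" and short: "\<bar>C\<bar> * (\<tau> t - \<tau> s) \<le> e / 2"
  shows "e / 2 * (\<tau> t - \<tau> s) \<le> \<Lambda> t - \<Lambda> s"
proof (rule deriv_ge_speed_imp_diff_ge_clock[OF st])
  fix x assume x: "x \<in> {s..t}"
  then have x': "x \<in> {a..<b}" using st by auto
  then show "(\<Lambda> has_real_derivative \<Lambda>' x) (at x)" by (rule der_\<Lambda>)
  have "- \<bar>C\<bar> * (\<tau> x - \<tau> s) \<le> f x - f s"
  proof (rule deriv_ge_speed_imp_diff_ge_clock)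
    fix y assume "y \<in> {s..x}"
    then have y: "y \<in> {a..<b}" using st x by (auto simp: subset_eq)
    then show "(f has_real_derivative f' y) (at y)" by (rule der_f)
    have "- \<bar>C\<bar> * \<gamma> y \<le> - C * \<gamma> y" using speed_pos[OF y] by (intro mult_right_mono) auto
    then show "- \<bar>C\<bar> * \<gamma> y \<le> f' y" using f'_ge[OF y] by linarith
  qed (use x st in \<open>auto simp: subset_eq\<close>)
  moreover have "\<bar>C\<bar> * (\<tau> x - \<tau> s) \<le> \<bar>C\<bar> * (\<tau> t - \<tau> s)"
    using clock_mono[of x t] x st by (intro mult_left_mono) (auto simp: subset_eq)
  ultimately have "e / 2 \<le> f x" using f_s short by linarith
  then have "e / 2 * \<gamma> x \<le> f x * \<gamma> x" using speed_pos[OF x'] by (intro mult_right_mono) auto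
  then show "e / 2 * \<gamma> x \<le> \<Lambda>' x" using \<Lambda>'_ge[OF x'] by (simp add: mult.commute)
qed

lemma barbalat:
  assumes f_nonneg: "\<And>t. t \<in> {a..<b} \<Longrightarrow> 0 \<le> f t"
    and \<Lambda>_bdd: "bdd_above (\<Lambda> ` {a..<b})"
  shows "(f \<longlongrightarrow> 0) (at_left b)"
proof (rule order_tendstoI)
  fix e :: real assume "e < 0"
  show "\<forall>\<^sub>F t in at_left b. e < f t"
    using eventually_in_at_left[OF a_less_b] by eventually_elim (use f_nonneg \<open>e < 0\<close> in force)
next
  fix e :: real assume "0 < e"
  define h where "h = e / (2 * (\<bar>C\<bar> + 1))"
  have h: "0 < h" "\<bar>C\<bar> * h \<le> e / 2" using \<open>0 < e\<close> by (auto simp: h_def field_simps)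
  have "Sup (\<Lambda> ` {a..<b}) - e / 2 * h < Sup (\<Lambda> ` {a..<b})" using h \<open>0 < e\<close> by simp
  then obtain r where r: "r \<in> {a..<b}" "Sup (\<Lambda> ` {a..<b}) - e / 2 * h < \<Lambda> r"
    using less_cSup_iff[OF _ \<Lambda>_bdd] a_less_b by fastforce
  have "f s < e" if s: "s \<in> {r..<b}" for s
  proof (rule ccontr)
    assume "\<not> f s < e"
    obtain t where t: "t \<in> {s..<b}" "\<tau> t = \<tau> s + h" using clock_runs[of s h] s r h by auto
    have "e / 2 * (\<tau> t - \<tau> s) \<le> \<Lambda> t - \<Lambda> s"
      by (rule clock_integral_ge) (use s r t h \<open>\<not> f s < e\<close> in auto)
    moreover have "\<Lambda> r \<le> \<Lambda> s"
    proof (rule deriv_nonneg_imp_le[OF _ subset_UNIV, where f = \<Lambda> and f' = \<Lambda>'])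
      fix y assume "y \<in> {r..s}"
      then have y: "y \<in> {a..<b}" using s r by auto
      then show "(\<Lambda> has_real_derivative \<Lambda>' y) (at y)" by (rule der_\<Lambda>)
      show "0 \<le> \<Lambda>' y"
        using mult_nonneg_nonneg[OF less_imp_le[OF speed_pos] f_nonneg, OF y y] \<Lambda>'_ge[OF y]
        by linarith
    qed (use s in simp)
    moreover have "\<Lambda> t \<le> Sup (\<Lambda> ` {a..<b})"
      by (rule cSup_upper[OF _ \<Lambda>_bdd]) (use t s r in auto)
    ultimately show False using r(2) t(2) by simp
  qed
  then show "\<forall>\<^sub>F t in at_left b. f t < e"
    using eventually_in_at_left[of r b] r by (auto elim!: eventually_mono)
qed

end

end

locale forced_logistic = diverging_clock +
  fixes w :: real and \<beta> F :: "real \<Rightarrow> real"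
  assumes der_\<beta>: "\<And>t. t \<in> {a..<b} \<Longrightarrow>
      (\<beta> has_real_derivative \<gamma> t * (\<beta> t * (w - \<beta> t) - F t)) (at t)"
    and \<beta>_bounds: "\<And>t. t \<in> {a..<b} \<Longrightarrow> \<beta> t \<in> {0..w}"
begin

lemma w_nonneg: "0 \<le> w"
  using \<beta>_bounds[of a] a_less_b by auto

lemma logistic_bounds:
  assumes "t \<in> {a..<b}"
  shows "0 \<le> \<beta> t * (w - \<beta> t)" "\<beta> t * (w - \<beta> t) \<le> w * w"
  using \<beta>_bounds[OF assms] w_nonneg by (auto intro!: mult_mono)

lemma convergent_if_transversal:
  assumes "finite Z"
    and trans: "\<And>c. c \<notin> Z \<Longrightarrow> c \<in> {0<..<w} \<Longrightarrow>
      (\<forall>\<^sub>F t in at_left b. \<beta> t = c \<longrightarrow> F t < c * (w - c)) \<or>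
      (\<forall>\<^sub>F t in at_left b. \<beta> t = c \<longrightarrow> c * (w - c) < F t)"
  obtains L where "(\<beta> \<longlongrightarrow> L) (at_left b)" "L \<in> {0..w}"
proof (rule transversal_convergent[OF a_less_b \<open>finite Z\<close> der_\<beta> \<beta>_bounds])
  fix c assume c: "c \<notin> Z" "c \<in> {0<..<w}"
  let ?\<beta>' = "\<lambda>t. \<gamma> t * (\<beta> t * (w - \<beta> t) - F t)"
  have "\<forall>\<^sub>F t in at_left b. 0 < \<gamma> t"
    using eventually_in_at_left[OF a_less_b] by eventually_elim (rule speed_pos)
  then have sgn: "\<forall>\<^sub>F t in at_left b. (0 < ?\<beta>' t \<longleftrightarrow> F t < \<beta> t * (w - \<beta> t)) \<and>
      (?\<beta>' t < 0 \<longleftrightarrow> \<beta> t * (w - \<beta> t) < F t)"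
    by eventually_elim (auto simp: zero_less_mult_iff mult_less_0_iff)
  from trans[OF c] show "(\<forall>\<^sub>F t in at_left b. \<beta> t = c \<longrightarrow> 0 < ?\<beta>' t) \<or>
      (\<forall>\<^sub>F t in at_left b. \<beta> t = c \<longrightarrow> ?\<beta>' t < 0)"
  proof (elim disjE)
    assume "\<forall>\<^sub>F t in at_left b. \<beta> t = c \<longrightarrow> F t < c * (w - c)"
    with sgn have "\<forall>\<^sub>F t in at_left b. \<beta> t = c \<longrightarrow> 0 < ?\<beta>' t" by eventually_elim auto
    then show ?thesis ..
  next
    assume "\<forall>\<^sub>F t in at_left b. \<beta> t = c \<longrightarrow> c * (w - c) < F t"
    with sgn have "\<forall>\<^sub>F t in at_left b. \<beta> t = c \<longrightarrow> ?\<beta>' t < 0" by eventually_elim auto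
    then show ?thesis ..
  qed
qed (use that in simp)

lemma convergent_if_forcing_convergent:
  assumes F: "(F \<longlongrightarrow> F0) (at_left b)"
  obtains L where "(\<beta> \<longlongrightarrow> L) (at_left b)" "L \<in> {0..w}"
proof (rule convergent_if_transversal)
  have "{c. c * (w - c) = F0} = {c. poly [:- F0, w, - 1:] c = 0}"
    by (auto simp: algebra_simps)
  then show "finite {c. c * (w - c) = F0}" using poly_roots_finite[of "[:- F0, w, - 1:]"] by simp
  fix c assume "c \<notin> {c. c * (w - c) = F0}"
  then have "(\<forall>\<^sub>F t in at_left b. F t < c * (w - c)) \<or> (\<forall>\<^sub>F t in at_left b. c * (w - c) < F t)"
    using order_tendstoD[OF F, of "c * (w - c)"] by (auto simp: neq_iff)
  then show "(\<forall>\<^sub>F t in at_left b. \<beta> t = c \<longrightarrow> F t < c * (w - c)) \<or>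
      (\<forall>\<^sub>F t in at_left b. \<beta> t = c \<longrightarrow> c * (w - c) < F t)"
    by (rule disj_forward) (auto elim: eventually_mono)
qed (use that in simp)

lemma forcing_not_at_top: "\<not> filterlim F at_top (at_left b)"
proof
  assume "filterlim F at_top (at_left b)"
  then have "\<forall>\<^sub>F t in at_left b. w * w + 1 \<le> F t" by (simp add: filterlim_at_top)
  then obtain d where d: "d < b" "\<And>t. d < t \<Longrightarrow> t < b \<Longrightarrow> w * w + 1 \<le> F t"
    unfolding eventually_at_left_field by blast
  obtain r where r: "max a d < r" "r < b" using dense[of "max a d" b] d a_less_b by auto
  then obtain t where t: "t \<in> {r..<b}" "\<tau> t = \<tau> r + (w + 1)"
    using clock_runs[of r "w + 1"] w_nonneg by auto
  have "1 * (\<tau> t - \<tau> r) \<le> - \<beta> t - - \<beta> r"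
  proof (rule deriv_ge_speed_imp_diff_ge_clock)
    fix x assume "x \<in> {r..t}"
    then have x: "x \<in> {a..<b}" "d < x" using r t by auto
    show "((\<lambda>t. - \<beta> t) has_real_derivative - (\<gamma> x * (\<beta> x * (w - \<beta> x) - F x))) (at x)"
      by (intro DERIV_minus der_\<beta> x)
    have "\<gamma> x * 1 \<le> \<gamma> x * - (\<beta> x * (w - \<beta> x) - F x)"
      using speed_pos[OF x(1)] logistic_bounds(2)[OF x(1)] d(2)[OF x(2)] x(1)
      by (intro mult_left_mono) auto
    then show "1 * \<gamma> x \<le> - (\<gamma> x * (\<beta> x * (w - \<beta> x) - F x))" by (simp add: algebra_simps)
  qed (use r t in auto)
  then show False using \<beta>_bounds[of r] \<beta>_bounds[of t] r t by auto
qed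

end

text \<open>Up to the nonincreasing factor \<open>F / Q\<close> this is a planar system of Lotka--Volterra type with
  equilibrium \<open>\<beta> = \<beta>\<^sub>0\<close>. The Lyapunov function is the first integral of the conservative case
  \<open>w = 2 * \<beta>\<^sub>0\<close>. \<open>Q\<close> may tend to 0, so monotonicity of the Lyapunov function only gives
  \<open>weight t * (\<beta> t - \<beta>\<^sub>0)\<^sup>2 \<longlongrightarrow> 0\<close>; but where \<open>\<beta>\<close> is away from \<open>\<beta>\<^sub>0\<close> this makes the forcing
  negligible, so all other levels are finally crossed upwards only.\<close>

locale lotka_volterra = forced_logistic +
  fixes F' Q :: "real \<Rightarrow> real" and \<beta>\<^sub>0 c \<epsilon> :: real
  assumes der_F: "\<And>t. t \<in> {a..<b} \<Longrightarrow> (F has_real_derivative F' t) (at t)"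
    and F'_le: "\<And>t. t \<in> {a..<b} \<Longrightarrow> F' t \<le> \<gamma> t * (c * (\<beta> t - \<beta>\<^sub>0)) * F t"
    and der_Q: "\<And>t. t \<in> {a..<b} \<Longrightarrow> (Q has_real_derivative \<gamma> t * (c * (\<beta> t - \<beta>\<^sub>0)) * Q t) (at t)"
    and Q_pos: "\<And>t. t \<in> {a..<b} \<Longrightarrow> 0 < Q t"
    and F_ge: "\<And>t. t \<in> {a..<b} \<Longrightarrow> \<epsilon> * Q t \<le> F t"
    and c_pos: "0 < c" and \<epsilon>_pos: "0 < \<epsilon>" and w_less: "w < 2 * \<beta>\<^sub>0"
begin

definition weight :: "real \<Rightarrow> real" where
  "weight t = Q t powr (2 / c)"

definition lyapunov :: "real \<Rightarrow> real" where
  "lyapunov t = weight t * (\<beta>\<^sub>0 * (w - \<beta>\<^sub>0) - (\<beta> t - \<beta>\<^sub>0)\<^sup>2 - 2 / (c + 2) * F t)"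

definition lyapunov' :: "real \<Rightarrow> real" where
  "lyapunov' t = \<gamma> t * (2 * (2 * \<beta>\<^sub>0 - w) * (weight t * (\<beta> t - \<beta>\<^sub>0)\<^sup>2)) +
    2 / (c + 2) * (weight t * (\<gamma> t * (c * (\<beta> t - \<beta>\<^sub>0)) * F t - F' t))"

lemma F_pos: "t \<in> {a..<b} \<Longrightarrow> 0 < F t"
  using F_ge[of t] Q_pos[of t] \<epsilon>_pos mult_pos_pos[of \<epsilon> "Q t"] by linarith

lemma weight_pos: "t \<in> {a..<b} \<Longrightarrow> 0 < weight t"
  using Q_pos[of t] by (simp add: weight_def)

lemma der_weight:
  assumes t: "t \<in> {a..<b}"
  shows "(weight has_real_derivative \<gamma> t * (2 * (\<beta> t - \<beta>\<^sub>0)) * weight t) (at t)"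
  unfolding weight_def[abs_def]
proof (rule DERIV_cong)
  show "((\<lambda>t. Q t powr (2 / c)) has_real_derivative
      2 / c * Q t powr (2 / c - 1) * (\<gamma> t * (c * (\<beta> t - \<beta>\<^sub>0)) * Q t)) (at t)"
    by (rule DERIV_chain2[where f = "\<lambda>x. x powr (2 / c)", OF has_real_derivative_powr der_Q])
      (use t Q_pos in auto)
  show "2 / c * Q t powr (2 / c - 1) * (\<gamma> t * (c * (\<beta> t - \<beta>\<^sub>0)) * Q t)
      = \<gamma> t * (2 * (\<beta> t - \<beta>\<^sub>0)) * Q t powr (2 / c)"
    using Q_pos[OF t] c_pos by (simp add: powr_diff)
qed

lemma der_lyapunov:
  assumes t: "t \<in> {a..<b}"
  shows "(lyapunov has_real_derivative lyapunov' t) (at t)"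
  unfolding lyapunov_def[abs_def]
proof (rule DERIV_cong)
  define y where "y = \<beta> t - \<beta>\<^sub>0"
  define K where "K = \<beta>\<^sub>0 * (w - \<beta>\<^sub>0)"
  define i where "i = 2 / (c + 2)"
  show "((\<lambda>t. weight t * (\<beta>\<^sub>0 * (w - \<beta>\<^sub>0) - (\<beta> t - \<beta>\<^sub>0)\<^sup>2 - 2 / (c + 2) * F t)) has_real_derivative
      \<gamma> t * (2 * y) * weight t * (K - y\<^sup>2 - i * F t) +
      (- (2 * y * (\<gamma> t * (K - y\<^sup>2 - (2 * \<beta>\<^sub>0 - w) * y - F t))) - i * F' t) * weight t) (at t)"
    unfolding y_def K_def i_def
    by (rule derivative_eq_intros der_weight[OF t] der_\<beta>[OF t] der_F[OF t] refl)+
      (simp add: algebra_simps power2_eq_square)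
  have "(c + 2) * i = 2" using c_pos by (simp add: i_def field_simps)
  moreover have "\<gamma> t * (2 * y) * weight t * (K - y\<^sup>2 - i * F t) +
      (- (2 * y * (\<gamma> t * (K - y\<^sup>2 - (2 * \<beta>\<^sub>0 - w) * y - F t))) - i * F' t) * weight t
      = lyapunov' t + \<gamma> t * y * weight t * F t * (2 - (c + 2) * i)"
    unfolding lyapunov'_def y_def[symmetric] i_def[symmetric]
    by (simp add: algebra_simps power2_eq_square)
  ultimately show "\<gamma> t * (2 * y) * weight t * (K - y\<^sup>2 - i * F t) +
      (- (2 * y * (\<gamma> t * (K - y\<^sup>2 - (2 * \<beta>\<^sub>0 - w) * y - F t))) - i * F' t) * weight t = lyapunov' t"
    by simp
qed

lemma lyapunov'_ge:
  assumes t: "t \<in> {a..<b}"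
  shows "\<gamma> t * (2 * (2 * \<beta>\<^sub>0 - w) * (weight t * (\<beta> t - \<beta>\<^sub>0)\<^sup>2)) \<le> lyapunov' t"
  using F'_le[OF t] weight_pos[OF t] c_pos by (simp add: lyapunov'_def)

lemma lyapunov_mono:
  assumes "a \<le> s" "s \<le> t" "t < b"
  shows "lyapunov s \<le> lyapunov t"
proof (rule deriv_nonneg_imp_le[OF \<open>s \<le> t\<close> subset_UNIV])
  fix x assume "x \<in> {s..t}"
  then have x: "x \<in> {a..<b}" using assms by auto
  show "(lyapunov has_real_derivative lyapunov' x) (at x)" by (rule der_lyapunov[OF x])
  have "0 \<le> \<gamma> x * (2 * (2 * \<beta>\<^sub>0 - w) * (weight x * (\<beta> x - \<beta>\<^sub>0)\<^sup>2))"
    using speed_pos[OF x] weight_pos[OF x] w_less by simp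
  then show "0 \<le> lyapunov' x" using lyapunov'_ge[OF x] by linarith
qed

lemma forcing_le:
  assumes t: "t \<in> {a..<b}"
  shows "F t \<le> F a / Q a * Q t"
proof -
  have "F t / Q t \<le> F a / Q a"
  proof (rule deriv_nonpos_imp_ge[OF _ subset_UNIV, where f = "\<lambda>t. F t / Q t"])
    fix x assume "x \<in> {a..t}"
    then have x: "x \<in> {a..<b}" using t by auto
    let ?q' = "\<gamma> x * (c * (\<beta> x - \<beta>\<^sub>0)) * Q x"
    show "((\<lambda>t. F t / Q t) has_real_derivative (F' x * Q x - F x * ?q') / (Q x * Q x)) (at x)"
      using Q_pos[OF x] by (intro DERIV_divide der_F der_Q x) auto
    have "F' x * Q x \<le> F x * ?q'"
      using mult_right_mono[OF F'_le[OF x], of "Q x"] Q_pos[OF x] by (simp add: mult_ac)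
    then show "(F' x * Q x - F x * ?q') / (Q x * Q x) \<le> 0" by (simp add: divide_nonpos_nonneg)
  qed (use t in simp)
  then show ?thesis using Q_pos[OF t] by (simp add: pos_divide_le_eq)
qed

lemma Q_bounded:
  obtains B where "1 \<le> B" "\<And>t. t \<in> {a..<b} \<Longrightarrow> Q t \<le> B"
proof
  define K where "K = \<beta>\<^sub>0 * (w - \<beta>\<^sub>0)"
  define B where "B = max 1 ((K + \<bar>lyapunov a\<bar> + 1) / (2 / (c + 2) * \<epsilon>))"
  show "1 \<le> B" by (simp add: B_def)
  fix t assume t: "t \<in> {a..<b}"
  show "Q t \<le> B"
  proof (rule ccontr)
    assume "\<not> Q t \<le> B"
    then have "1 < Q t" "(K + \<bar>lyapunov a\<bar> + 1) / (2 / (c + 2) * \<epsilon>) < Q t" by (auto simp: B_def)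
    then have "K + \<bar>lyapunov a\<bar> + 1 < 2 / (c + 2) * \<epsilon> * Q t"
      using \<epsilon>_pos c_pos by (subst (asm) pos_divide_less_eq) (auto simp: mult_ac)
    also have "\<dots> \<le> 2 / (c + 2) * F t"
      using F_ge[OF t] c_pos unfolding mult.assoc by (intro mult_left_mono) auto
    finally have "K - (\<beta> t - \<beta>\<^sub>0)\<^sup>2 - 2 / (c + 2) * F t \<le> - (\<bar>lyapunov a\<bar> + 1)"
      using zero_le_power2[of "\<beta> t - \<beta>\<^sub>0"] by linarith
    moreover have "1 \<le> weight t" using \<open>1 < Q t\<close> c_pos by (simp add: weight_def ge_one_powr_ge_zero)
    ultimately have "lyapunov t \<le> weight t * - (\<bar>lyapunov a\<bar> + 1)"
      unfolding lyapunov_def K_def[symmetric] by (intro mult_left_mono) auto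
    also have "\<dots> \<le> 1 * - (\<bar>lyapunov a\<bar> + 1)"
      using \<open>1 \<le> weight t\<close> by (intro mult_right_mono_neg) auto
    finally have "lyapunov t \<le> 1 * - (\<bar>lyapunov a\<bar> + 1)" .
    then show False using lyapunov_mono[of a t] t by auto
  qed
qed

lemma weight_bounded:
  obtains B where "1 \<le> B" "\<And>t. t \<in> {a..<b} \<Longrightarrow> weight t \<le> B"
proof -
  obtain B where B: "1 \<le> B" "\<And>t. t \<in> {a..<b} \<Longrightarrow> Q t \<le> B" by (rule Q_bounded) blast
  show ?thesis
  proof
    show "1 \<le> B powr (2 / c)" using B(1) c_pos by (simp add: ge_one_powr_ge_zero)
    show "weight t \<le> B powr (2 / c)" if "t \<in> {a..<b}" for t
      unfolding weight_def using B(2)[OF that] Q_pos[OF that] c_pos by (intro powr_mono2) auto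
  qed
qed

lemma lyapunov_bdd_above: "bdd_above (lyapunov ` {a..<b})"
proof -
  obtain B where B: "1 \<le> B" "\<And>t. t \<in> {a..<b} \<Longrightarrow> weight t \<le> B" by (rule weight_bounded) blast
  define K where "K = \<beta>\<^sub>0 * (w - \<beta>\<^sub>0)"
  show ?thesis
  proof (rule bdd_aboveI2)
    fix t assume t: "t \<in> {a..<b}"
    have "0 \<le> 2 / (c + 2) * F t" using F_pos[OF t] c_pos by simp
    then have "K - (\<beta> t - \<beta>\<^sub>0)\<^sup>2 - 2 / (c + 2) * F t \<le> \<bar>K\<bar>"
      using zero_le_power2[of "\<beta> t - \<beta>\<^sub>0"] by linarith
    then have "lyapunov t \<le> weight t * \<bar>K\<bar>"
      unfolding lyapunov_def K_def[symmetric] using weight_pos[OF t] by (intro mult_left_mono) auto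
    also have "\<dots> \<le> B * \<bar>K\<bar>" using B(2)[OF t] by (intro mult_right_mono) auto
    finally show "lyapunov t \<le> B * \<bar>K\<bar>" .
  qed
qed

lemma weighted_deviation_tendsto_0: "((\<lambda>t. weight t * (\<beta> t - \<beta>\<^sub>0)\<^sup>2) \<longlongrightarrow> 0) (at_left b)"
proof -
  obtain B where B: "1 \<le> B" "\<And>t. t \<in> {a..<b} \<Longrightarrow> Q t \<le> B" by (rule Q_bounded) blast
  obtain W where W: "1 \<le> W" "\<And>t. t \<in> {a..<b} \<Longrightarrow> weight t \<le> W" by (rule weight_bounded) blast
  define D where "D = 2 * (2 * \<beta>\<^sub>0 - w)"
  have "0 < D" using w_less by (simp add: D_def)
  define G where "G = w * w + F a / Q a * B"
  define Y where "Y = \<bar>\<beta>\<^sub>0\<bar> + w"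
  define g where "g t =
    2 * (\<beta> t - \<beta>\<^sub>0) * weight t * ((\<beta> t - \<beta>\<^sub>0)\<^sup>2 + (\<beta> t * (w - \<beta> t) - F t))" for t
  have g_bound: "\<bar>g t\<bar> \<le> 2 * Y * W * (Y\<^sup>2 + G)" if t: "t \<in> {a..<b}" for t
  proof -
    have "F a / Q a * Q t \<le> F a / Q a * B"
      using B(2)[OF t] F_pos[of a] Q_pos[of a] a_less_b by (intro mult_left_mono) auto
    then have F_le: "F t \<le> F a / Q a * B" using forcing_le[OF t] by linarith
    have "\<bar>\<beta> t * (w - \<beta> t) - F t\<bar> \<le> G"
      using F_le F_pos[OF t] logistic_bounds[OF t] unfolding G_def by linarith
    moreover have "\<bar>\<beta> t - \<beta>\<^sub>0\<bar> \<le> Y" using \<beta>_bounds[OF t] by (auto simp: Y_def)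
    ultimately show ?thesis
      unfolding g_def abs_mult
      using W(2)[OF t] weight_pos[OF t] W(1)
      by (intro mult_mono order_trans[OF abs_triangle_ineq] add_mono)
        (auto simp: abs_le_square_iff[symmetric])
  qed
  have "((\<lambda>t. D * (weight t * (\<beta> t - \<beta>\<^sub>0)\<^sup>2)) \<longlongrightarrow> 0) (at_left b)"
  proof (rule barbalat[OF _ _ der_lyapunov _ _ lyapunov_bdd_above])
    fix t assume t: "t \<in> {a..<b}"
    show "((\<lambda>t. D * (weight t * (\<beta> t - \<beta>\<^sub>0)\<^sup>2)) has_real_derivative D * (\<gamma> t * g t)) (at t)"
      unfolding g_def
      by (rule derivative_eq_intros der_weight[OF t] der_\<beta>[OF t] refl)+
        (simp add: algebra_simps power2_eq_square)
    have "- (2 * Y * W * (Y\<^sup>2 + G)) \<le> g t" using g_bound[OF t] by auto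
    then have "D * (\<gamma> t * - (2 * Y * W * (Y\<^sup>2 + G))) \<le> D * (\<gamma> t * g t)"
      using \<open>0 < D\<close> speed_pos[OF t] by (intro mult_left_mono) auto
    then show "- (D * (2 * Y * W * (Y\<^sup>2 + G))) * \<gamma> t \<le> D * (\<gamma> t * g t)" by (simp add: mult_ac)
    show "0 \<le> D * (weight t * (\<beta> t - \<beta>\<^sub>0)\<^sup>2)" using \<open>0 < D\<close> weight_pos[OF t] by simp
    show "\<gamma> t * (D * (weight t * (\<beta> t - \<beta>\<^sub>0)\<^sup>2)) \<le> lyapunov' t"
      using lyapunov'_ge[OF t] by (simp add: D_def)
  qed
  from tendsto_divide_zero[OF this, of D] show ?thesis using \<open>0 < D\<close> by simp
qed

lemma lotka_volterra_convergent:
  obtains L where "(\<beta> \<longlongrightarrow> L) (at_left b)" "L \<in> {0..w}"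
proof (rule convergent_if_transversal)
  show "finite {\<beta>\<^sub>0}" by simp
  fix x assume x: "x \<notin> {\<beta>\<^sub>0}" "x \<in> {0<..<w}"
  then have "(x - \<beta>\<^sub>0)\<^sup>2 \<noteq> 0" by simp
  define Q_on_level where
    "Q_on_level t = (weight t * (\<beta> t - \<beta>\<^sub>0)\<^sup>2 / (x - \<beta>\<^sub>0)\<^sup>2) powr (c / 2)" for t
  have "(Q_on_level \<longlongrightarrow> (0 / (x - \<beta>\<^sub>0)\<^sup>2) powr (c / 2)) (at_left b)"
    unfolding Q_on_level_def[abs_def]
  proof (rule tendsto_powr2)
    show "\<forall>\<^sub>F t in at_left b. 0 \<le> weight t * (\<beta> t - \<beta>\<^sub>0)\<^sup>2 / (x - \<beta>\<^sub>0)\<^sup>2"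
      using eventually_in_at_left[OF a_less_b]
      by eventually_elim (use weight_pos in \<open>simp add: less_imp_le\<close>)
  qed
    (use c_pos \<open>(x - \<beta>\<^sub>0)\<^sup>2 \<noteq> 0\<close> in \<open>auto intro!: tendsto_divide_zero weighted_deviation_tendsto_0\<close>)
  then have "((\<lambda>t. F a / Q a * Q_on_level t) \<longlongrightarrow> F a / Q a * 0) (at_left b)"
    using c_pos by (intro tendsto_mult tendsto_const) simp
  then have "\<forall>\<^sub>F t in at_left b. F a / Q a * Q_on_level t < x * (w - x)"
    by (rule order_tendstoD) (use x in simp)
  with eventually_in_at_left[OF a_less_b]
  have "\<forall>\<^sub>F t in at_left b. \<beta> t = x \<longrightarrow> F t < x * (w - x)"
  proof eventually_elim
    case (elim t)
    have "Q_on_level t = Q t" if "\<beta> t = x"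
      using that \<open>(x - \<beta>\<^sub>0)\<^sup>2 \<noteq> 0\<close> Q_pos[of t] elim c_pos
      by (simp add: Q_on_level_def weight_def powr_powr)
    then show ?case using elim forcing_le[of t] by fastforce
  qed
  then show "(\<forall>\<^sub>F t in at_left b. \<beta> t = x \<longrightarrow> F t < x * (w - x)) \<or>
      (\<forall>\<^sub>F t in at_left b. \<beta> t = x \<longrightarrow> x * (w - x) < F t)" ..
qed (use that in simp)

end

section \<open>Riccati equations with a common inhomogeneity\<close>

locale riccati_family =
  fixes I :: "nat set" and T :: real and lam :: "nat \<Rightarrow> real \<Rightarrow> real" and q :: "real \<Rightarrow> real"
  assumes T_pos: "0 < T"
    and der_lam: "\<And>i t. i \<in> I \<Longrightarrow> t \<in> {0..<T} \<Longrightarrow>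
      (lam i has_real_derivative - (lam i t)\<^sup>2 + q t) (at t within {0..<T})"
begin

abbreviation u :: "nat \<Rightarrow> real \<Rightarrow> real" where "u \<equiv> u_fun lam"

lemma u_pos [simp]: "0 < u i t"
  by (simp add: u_fun_def)

lemma u_nonzero [simp]: "u i t \<noteq> 0"
  using u_pos[of i t] by linarith

lemma u_0 [simp]: "u i 0 = 1"
  by (simp add: u_fun_def)

lemma der_integral_lam:
  assumes i: "i \<in> I" and t: "t \<in> {0..<T}"
  shows "((\<lambda>t. integral {0..t} (lam i)) has_real_derivative lam i t) (at t within {0..<T})"
proof -
  obtain b where b: "t < b" "b < T" using dense[of t T] t by auto
  have "continuous_on {0..<T} (lam i)" by (rule DERIV_continuous_on[OF der_lam[OF i]])
  then have "continuous_on {0..b} (lam i)" by (rule continuous_on_subset) (use b in auto)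
  then have "((\<lambda>t. integral {0..t} (lam i)) has_real_derivative lam i t) (at t within {0..b})"
    using b t by (intro integral_has_real_derivative) auto
  moreover have "at t within {0..<T} = at t within {0..b}"
    by (rule at_within_nhd[of _ "{..<b}"]) (use b in auto)
  ultimately show ?thesis by simp
qed

lemma der_u:
  assumes "i \<in> I" "t \<in> {0..<T}"
  shows "(u i has_real_derivative lam i t * u i t) (at t within {0..<T})"
  unfolding u_fun_def[abs_def]
  by (rule derivative_eq_intros der_integral_lam[OF assms] refl)+ simp

lemma der_lam_u:
  assumes "i \<in> I" "t \<in> {0..<T}"
  shows "((\<lambda>t. lam i t * u i t) has_real_derivative q t * u i t) (at t within {0..<T})"
  by (rule DERIV_cong[OF DERIV_mult[OF der_lam[OF assms] der_u[OF assms]]])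
    (simp add: algebra_simps power2_eq_square)

lemma wronskian:
  assumes i: "i \<in> I" and j: "j \<in> I" and t: "t \<in> {0..<T}"
  shows "u i t * u j t * (lam j t - lam i t) = lam j 0 - lam i 0"
proof -
  let ?W = "\<lambda>t. u i t * u j t * (lam j t - lam i t)"
  have "?W 0 = ?W t"
  proof (rule deriv_zero_imp_eq[of 0 t "{0..<T}" ?W])
    fix s assume "s \<in> {0..t}"
    then have s: "s \<in> {0..<T}" using t by auto
    show "(?W has_real_derivative 0) (at s within {0..<T})"
      by (rule derivative_eq_intros der_u[OF i s] der_u[OF j s] der_lam[OF i s] der_lam[OF j s]
          refl)+
        (simp add: algebra_simps power2_eq_square)
  qed (use t in auto)
  then show ?thesis by simp
qed

lemma lam_mono:
  assumes "i \<in> I" "j \<in> I" "t \<in> {0..<T}" "lam i 0 \<le> lam j 0"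
  shows "lam i t \<le> lam j t"
proof -
  have "0 \<le> u i t * u j t * (lam j t - lam i t)" using wronskian[OF assms(1-3)] assms(4) by simp
  moreover have "0 < u i t * u j t" by simp
  ultimately show ?thesis by (simp only: zero_le_mult_iff) auto
qed

lemma der_ratio:
  assumes i: "i \<in> I" and j: "j \<in> I" and t: "t \<in> {0..<T}"
  shows "((\<lambda>t. u j t / u i t) has_real_derivative (lam j 0 - lam i 0) / (u i t)\<^sup>2)
    (at t within {0..<T})"
proof (rule DERIV_cong[OF DERIV_divide[OF der_u[OF j t] der_u[OF i t]]])
  show "(lam j t * u j t * u i t - u j t * (lam i t * u i t)) / (u i t * u i t)
    = (lam j 0 - lam i 0) / (u i t)\<^sup>2"
    unfolding wronskian[OF i j t, symmetric] by (simp add: power2_eq_square algebra_simps)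
qed simp

lemma u_mono:
  assumes i: "i \<in> I" and j: "j \<in> I" and t: "t \<in> {0..<T}" and le: "lam i 0 \<le> lam j 0"
  shows "u i t \<le> u j t"
proof -
  have "u j 0 / u i 0 \<le> u j t / u i t"
    by (rule deriv_nonneg_imp_le[of 0 t "{0..<T}" "\<lambda>t. u j t / u i t", OF _ _ der_ratio[OF i j]])
      (use t le in auto)
  then show ?thesis by (simp add: le_divide_eq)
qed

lemma u_affine_dependence:
  assumes i: "i \<in> I" and j: "j \<in> I" and k: "k \<in> I" and t: "t \<in> {0..<T}"
  shows "(lam j 0 - lam i 0) * (u k t - u i t) = (lam k 0 - lam i 0) * (u j t - u i t)"
proof -
  let ?f = "\<lambda>t. (lam j 0 - lam i 0) * (u k t / u i t) - (lam k 0 - lam i 0) * (u j t / u i t)"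
  have "?f 0 = ?f t"
  proof (rule deriv_zero_imp_eq[of 0 t "{0..<T}" ?f])
    fix s assume "s \<in> {0..t}"
    then have s: "s \<in> {0..<T}" using t by auto
    show "(?f has_real_derivative 0) (at s within {0..<T})"
      by (rule DERIV_cong[OF DERIV_diff[OF
            DERIV_cmult[OF der_ratio[OF i k s]] DERIV_cmult[OF der_ratio[OF i j s]]]])
        simp
  qed (use t in auto)
  moreover define x y where "x = u k t / u i t" and "y = u j t / u i t"
  ultimately have "(lam j 0 - lam i 0) * (x - 1) = (lam k 0 - lam i 0) * (y - 1)"
    by (simp add: algebra_simps)
  moreover have "u k t = x * u i t" "u j t = y * u i t" by (simp_all add: x_def y_def)
  ultimately show ?thesis by algebra
qed

end

section \<open>The flow and its blow-up\<close>

locale density_flow =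
  fixes n :: nat and k cb rho0 tB :: real
    and lam0 :: "nat \<Rightarrow> real" and lam :: "nat \<Rightarrow> real \<Rightarrow> real" and rho :: "real \<Rightarrow> real"
  assumes n_pos: "1 \<le> n" and k_pos: "0 < k" and cb_pos: "0 < cb" and rho0_pos: "0 < rho0"
    and solution: "is_solution n k cb rho0 lam0 tB lam rho"
    and lam0_min: "\<And>i. i \<in> {1..n} \<Longrightarrow> lam0 1 \<le> lam0 i"
begin

definition \<kappa> :: real where "\<kappa> = k / real n"

lemma \<kappa>_pos: "0 < \<kappa>"
  using k_pos n_pos by (simp add: \<kappa>_def)

lemma rho_0: "rho 0 = rho0"
  and lam_0: "i \<in> {1..n} \<Longrightarrow> lam i 0 = lam0 i"
  and der_rho: "t \<in> {0..<tB} \<Longrightarrow>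
    (rho has_real_derivative - rho t * (\<Sum>i=1..n. lam i t)) (at t within {0..<tB})"
  using solution by (auto simp: is_solution_def)

sublocale riccati_family "{1..n}" tB lam "\<lambda>t. \<kappa> * (rho t - cb)"
  by unfold_locales (use solution in \<open>auto simp: is_solution_def \<kappa>_def\<close>)

lemma one_index: "1 \<in> {1..n}"
  using n_pos by simp

lemma u_1_le: "i \<in> {1..n} \<Longrightarrow> t \<in> {0..<tB} \<Longrightarrow> u 1 t \<le> u i t"
  using u_mono[OF one_index] lam0_min by (simp add: lam_0)

lemma lam_1_le: "i \<in> {1..n} \<Longrightarrow> t \<in> {0..<tB} \<Longrightarrow> lam 1 t \<le> lam i t"
  using lam_mono[OF one_index] lam0_min by (simp add: lam_0)

lemma der_prod_u:
  assumes "A \<subseteq> {1..n}" "t \<in> {0..<tB}"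
  shows "((\<lambda>t. \<Prod>i\<in>A. u i t) has_real_derivative (\<Prod>i\<in>A. u i t) * (\<Sum>i\<in>A. lam i t))
    (at t within {0..<tB})"
  using finite_subset[OF assms(1) finite_atLeastAtMost] assms(1)
proof induction
  case (insert i A)
  then have "((\<lambda>t. u i t * (\<Prod>i\<in>A. u i t)) has_real_derivative
      lam i t * u i t * (\<Prod>i\<in>A. u i t) + (\<Prod>i\<in>A. u i t) * (\<Sum>i\<in>A. lam i t) * u i t)
      (at t within {0..<tB})"
    using assms(2) by (intro DERIV_mult der_u) auto
  then show ?case using insert by (simp add: algebra_simps)
qed simp

lemma mass_conservation:
  assumes t: "t \<in> {0..<tB}"
  shows "rho t * (\<Prod>i=1..n. u i t) = rho0"
proof -
  let ?m = "\<lambda>t. rho t * (\<Prod>i=1..n. u i t)"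
  have "?m 0 = ?m t"
  proof (rule deriv_zero_imp_eq[of 0 t "{0..<tB}" ?m])
    fix s assume "s \<in> {0..t}"
    then have s: "s \<in> {0..<tB}" using t by auto
    show "(?m has_real_derivative 0) (at s within {0..<tB})"
      by (rule DERIV_cong[OF DERIV_mult[OF der_rho[OF s] der_prod_u[OF subset_refl s]]])
        (simp add: algebra_simps)
  qed (use t in auto)
  then show ?thesis by (simp add: rho_0)
qed

lemma prod_u_pos: "0 < (\<Prod>i\<in>A. u i t)"
  by (simp add: prod_pos)

lemma rho_eq: "t \<in> {0..<tB} \<Longrightarrow> rho t = rho0 / (\<Prod>i=1..n. u i t)"
  using mass_conservation[of t] prod_u_pos[of t "{1..n}"] by (simp add: field_simps)

lemma rho_pos: "t \<in> {0..<tB} \<Longrightarrow> 0 < rho t"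
  using rho0_pos prod_u_pos[of t "{1..n}"] by (simp add: rho_eq)

lemma rho_le_if_u_1_ge:
  assumes "0 < \<delta>" and t: "t \<in> {0..<tB}" and "\<delta> \<le> u 1 t"
  shows "rho t \<le> rho0 / \<delta> ^ n"
proof -
  have "(\<Prod>i=1..n. \<delta>) \<le> (\<Prod>i=1..n. u i t)"
    using assms order_trans[OF _ u_1_le[OF _ t]] by (intro prod_mono) auto
  then show ?thesis
    unfolding rho_eq[OF t] using rho0_pos \<open>0 < \<delta>\<close> prod_u_pos[of t "{1..n}"]
    by (intro divide_left_mono) auto
qed

lemma lam_bdd_above:
  assumes "bdd_above (rho ` {0..<tB})" and i: "i \<in> {1..n}"
  shows "bdd_above (lam i ` {0..<tB})"
proof -
  obtain R where R: "\<And>t. t \<in> {0..<tB} \<Longrightarrow> rho t \<le> R" using assms(1) by (meson bdd_above.E imageI)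
  show ?thesis
  proof (rule deriv_bounded_above_imp_bdd_above[OF der_lam[OF i]])
    fix t assume "t \<in> {0..<tB}"
    then have "\<kappa> * (rho t - cb) \<le> \<kappa> * R" using R[of t] \<kappa>_pos cb_pos by (intro mult_left_mono) auto
    then show "- (lam i t)\<^sup>2 + \<kappa> * (rho t - cb) \<le> \<kappa> * R"
      using zero_le_power2[of "lam i t"] by linarith
  qed
qed

lemma u_bdd_above:
  assumes "bdd_above (lam i ` {0..<tB})" and i: "i \<in> {1..n}"
  shows "bdd_above (u i ` {0..<tB})"
proof -
  obtain L where L: "\<And>t. t \<in> {0..<tB} \<Longrightarrow> lam i t \<le> L" using assms(1) by (meson bdd_above.E imageI)
  have "bdd_above ((\<lambda>t. integral {0..t} (lam i)) ` {0..<tB})"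
    using der_integral_lam[OF i] L by (rule deriv_bounded_above_imp_bdd_above)
  then obtain M where "\<And>t. t \<in> {0..<tB} \<Longrightarrow> integral {0..t} (lam i) \<le> M" by (meson bdd_above.E imageI)
  then show ?thesis by (intro bdd_aboveI2[where M = "exp M"]) (simp add: u_fun_def)
qed

lemma lam_bdd_below:
  assumes "0 < \<delta>" and \<delta>: "\<And>t. t \<in> {0..<tB} \<Longrightarrow> \<delta> \<le> u i t"
    and "bdd_above (u i ` {0..<tB})" and i: "i \<in> {1..n}"
  shows "bdd_below (lam i ` {0..<tB})"
proof -
  obtain U where U: "\<And>t. t \<in> {0..<tB} \<Longrightarrow> u i t \<le> U" using assms(3) by (meson bdd_above.E imageI)
  have "bdd_below ((\<lambda>t. lam i t * u i t) ` {0..<tB})"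
  proof (rule deriv_bounded_below_imp_bdd_below[OF der_lam_u[OF i]])
    fix t assume t: "t \<in> {0..<tB}"
    have "\<kappa> * cb * u i t \<le> \<kappa> * cb * U" using U[OF t] \<kappa>_pos cb_pos by simp
    moreover have "- (\<kappa> * cb * u i t) \<le> \<kappa> * (rho t - cb) * u i t"
      using rho_pos[OF t] \<kappa>_pos less_imp_le[OF u_pos] by (simp add: algebra_simps)
    ultimately show "- (\<kappa> * cb * U) \<le> \<kappa> * (rho t - cb) * u i t" by linarith
  qed
  then obtain m where m: "\<And>t. t \<in> {0..<tB} \<Longrightarrow> m \<le> lam i t * u i t" by (meson bdd_below.E imageI)
  show ?thesis
  proof (rule bdd_belowI2)
    fix t assume t: "t \<in> {0..<tB}"
    have "- (\<bar>m\<bar> / \<delta>) \<le> - (\<bar>m\<bar> / u i t)" using \<delta>[OF t] \<open>0 < \<delta>\<close> by (simp add: divide_left_mono)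
    also have "\<dots> \<le> m / u i t"
      using divide_right_mono[OF _ less_imp_le[OF u_pos], of "- \<bar>m\<bar>" m i t] by simp
    also have "\<dots> \<le> lam i t" using m[OF t] by (simp add: pos_divide_le_eq)
    finally show "- (\<bar>m\<bar> / \<delta>) \<le> lam i t" .
  qed
qed

lemma bounded_if_u_1_bounded_below:
  assumes "0 < \<delta>" and \<delta>: "\<And>t. t \<in> {0..<tB} \<Longrightarrow> \<delta> \<le> u 1 t"
  shows "i \<in> {1..n} \<Longrightarrow> bounded (lam i ` {0..<tB})" "bounded (rho ` {0..<tB})"
proof -
  have rho: "bdd_above (rho ` {0..<tB})"
    using rho_le_if_u_1_ge[OF \<open>0 < \<delta>\<close> _ \<delta>] by (intro bdd_aboveI2) auto
  moreover have "bdd_below (rho ` {0..<tB})"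
    using rho_pos by (intro bdd_belowI2[where m = 0]) (simp add: less_imp_le)
  ultimately show "bounded (rho ` {0..<tB})" by (intro bdd_below_above_imp_bounded)
  assume i: "i \<in> {1..n}"
  have "bdd_below (lam 1 ` {0..<tB})"
    by (intro lam_bdd_below[OF \<open>0 < \<delta>\<close> \<delta>] u_bdd_above lam_bdd_above[OF rho] one_index)
  then obtain m where "\<And>t. t \<in> {0..<tB} \<Longrightarrow> m \<le> lam 1 t" by (meson bdd_below.E imageI)
  then have "bdd_below (lam i ` {0..<tB})"
    using lam_1_le[OF i] by (intro bdd_belowI2[where m = m]) (blast intro: order_trans)
  then show "bounded (lam i ` {0..<tB})"
    using lam_bdd_above[OF rho i] by (intro bdd_below_above_imp_bounded)
qed

end

locale maximal_flow = density_flow +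
  assumes maximal: "maximal_solution n k cb rho0 lam0 tB lam rho"
begin

lemma u_1_not_bounded_below:
  assumes "0 < \<delta>"
  obtains t where "t \<in> {0..<tB}" "u 1 t < \<delta>"
proof (rule ccontr)
  assume "\<not> thesis"
  then have "\<And>t. t \<in> {0..<tB} \<Longrightarrow> \<delta> \<le> u 1 t" using that by force
  from bounded_solution_extends[OF solution bounded_if_u_1_bounded_below[OF \<open>0 < \<delta>\<close> this]]
  show False using maximal by (auto simp: maximal_solution_def)
qed

lemma u_1_not_eventually_bounded_below:
  assumes "0 < \<delta>"
  shows "\<not> (\<forall>\<^sub>F t in at_left tB. \<delta> \<le> u 1 t)"
proof
  assume "\<forall>\<^sub>F t in at_left tB. \<delta> \<le> u 1 t"
  then obtain d where d: "d < tB" "\<And>t. d < t \<Longrightarrow> t < tB \<Longrightarrow> \<delta> \<le> u 1 t"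
    unfolding eventually_at_left_field by blast
  define r where "r = max 0 d"
  have "r < tB" using d T_pos by (simp add: r_def)
  have "continuous_on {0..<tB} (u 1)" by (rule DERIV_continuous_on[OF der_u[OF one_index]])
  then have "continuous_on {0..r} (u 1)" by (rule continuous_on_subset) (use \<open>r < tB\<close> in auto)
  moreover have "{0..r} \<noteq> {}" by (simp add: r_def)
  ultimately obtain x where x: "\<And>t. t \<in> {0..r} \<Longrightarrow> u 1 x \<le> u 1 t"
    using continuous_attains_inf[OF compact_Icc] by blast
  obtain t where "t \<in> {0..<tB}" "u 1 t < min \<delta> (u 1 x)"
    using u_1_not_bounded_below[of "min \<delta> (u 1 x)"] \<open>0 < \<delta>\<close> by auto
  moreover have "t \<in> {0..r} \<or> d < t" using \<open>t \<in> {0..<tB}\<close> by (auto simp: r_def)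
  ultimately show False using d(2)[of t] x[of t] by auto
qed

text \<open>Since \<open>u'' = \<kappa> * (rho - cb) * u\<close> and \<open>\<phi>'' = - \<kappa> * cb * \<phi>\<close>, dividing by \<open>\<phi>\<close> removes the
  negative part of the coefficient: \<open>v i = u i / \<phi>\<close> is convex in the time variable with
  differential \<open>dt / \<phi>\<^sup>2\<close>, and \<open>V i\<close> is its derivative with respect to that time. From \<open>t0\<close> on,
  \<open>\<phi>\<close> lies between \<open>cos 1\<close> and 1.\<close>

definition \<omega> :: real where "\<omega> = sqrt (\<kappa> * cb)"

definition t0 :: real where "t0 = max (tB / 2) (tB - 1 / \<omega>)"

definition \<phi> :: "real \<Rightarrow> real" where "\<phi> t = cos (\<omega> * (tB - t))"

definition \<psi> :: "real \<Rightarrow> real" where "\<psi> t = \<omega> * sin (\<omega> * (tB - t))"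

definition v :: "nat \<Rightarrow> real \<Rightarrow> real" where "v i t = u i t / \<phi> t"

definition V :: "nat \<Rightarrow> real \<Rightarrow> real" where "V i t = lam i t * u i t * \<phi> t - u i t * \<psi> t"

lemma \<omega>_pos: "0 < \<omega>"
  using \<kappa>_pos cb_pos by (simp add: \<omega>_def)

lemma \<omega>_squared: "\<omega> * \<omega> = \<kappa> * cb"
  using \<kappa>_pos cb_pos by (simp add: \<omega>_def)

lemma t0_pos: "0 < t0" and t0_less: "t0 < tB"
  using T_pos \<omega>_pos by (auto simp: t0_def less_max_iff_disj)

lemma late: "t \<in> {t0..<tB} \<Longrightarrow> t \<in> {0..<tB}"
  using t0_pos by auto

lemma eventually_late: "\<forall>\<^sub>F t in at_left tB. t \<in> {t0..<tB}"
  by (rule eventually_in_at_left[OF t0_less])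

lemma late_phase:
  assumes "t \<in> {t0..<tB}"
  shows "0 \<le> \<omega> * (tB - t)" "\<omega> * (tB - t) \<le> 1"
proof -
  show "0 \<le> \<omega> * (tB - t)" using assms \<omega>_pos by auto
  have "tB - t \<le> 1 / \<omega>" using assms by (auto simp: t0_def)
  then show "\<omega> * (tB - t) \<le> 1" using \<omega>_pos by (simp add: field_simps)
qed

lemma cos_1_pos: "0 < cos (1::real)"
  using pi_gt3 by (intro cos_gt_zero_pi) auto

lemma \<phi>_ge: "t \<in> {t0..<tB} \<Longrightarrow> cos 1 \<le> \<phi> t"
  unfolding \<phi>_def using late_phase[of t] pi_gt3 by (intro cos_monotone_0_pi_le) auto

lemma \<phi>_pos: "t \<in> {t0..<tB} \<Longrightarrow> 0 < \<phi> t"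
  using \<phi>_ge[of t] cos_1_pos by linarith

lemma \<phi>_le_1: "\<phi> t \<le> 1"
  by (simp add: \<phi>_def)

lemma \<psi>_nonneg: "t \<in> {t0..<tB} \<Longrightarrow> 0 \<le> \<psi> t"
  unfolding \<psi>_def using late_phase[of t] \<omega>_pos pi_gt3
  by (intro mult_nonneg_nonneg sin_ge_zero) auto

lemma der_\<phi>: "(\<phi> has_real_derivative \<psi> t) (at t)"
  unfolding \<phi>_def[abs_def] \<psi>_def by (rule derivative_eq_intros refl | simp)+

lemma der_\<psi>: "(\<psi> has_real_derivative - \<kappa> * cb * \<phi> t) (at t)"
  unfolding \<psi>_def[abs_def] \<phi>_def minus_mult_left[symmetric] \<omega>_squared[symmetric]
  by (rule derivative_eq_intros refl | simp)+

lemma \<phi>_lim: "(\<phi> \<longlongrightarrow> 1) (at_left tB)" and \<psi>_lim: "(\<psi> \<longlongrightarrow> 0) (at_left tB)"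
  using DERIV_isCont[OF der_\<phi>, of tB] DERIV_isCont[OF der_\<psi>, of tB]
  by (auto simp: isCont_def \<phi>_def \<psi>_def intro: tendsto_within_subset)

lemma at_late: "t \<in> {t0..<tB} \<Longrightarrow> at t within {0..<tB} = at t"
  using t0_pos by (intro at_within_interior) auto

lemma der_V:
  assumes i: "i \<in> {1..n}" and t: "t \<in> {t0..<tB}"
  shows "(V i has_real_derivative \<kappa> * rho t * u i t * \<phi> t) (at t)"
  unfolding V_def[abs_def]
  by (rule derivative_eq_intros der_lam_u[OF i late[OF t], unfolded at_late[OF t]]
      der_u[OF i late[OF t], unfolded at_late[OF t]] der_\<phi> der_\<psi> refl)+
    (simp add: algebra_simps)

lemma der_v:
  assumes i: "i \<in> {1..n}" and t: "t \<in> {t0..<tB}"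
  shows "(v i has_real_derivative V i t / (\<phi> t)\<^sup>2) (at t)"
  unfolding v_def[abs_def]
  by (rule DERIV_cong[OF DERIV_divide[OF der_u[OF i late[OF t], unfolded at_late[OF t]] der_\<phi>]])
    (use \<phi>_pos[OF t] in \<open>auto simp: V_def power2_eq_square algebra_simps\<close>)

lemma u_eq_v: "t \<in> {t0..<tB} \<Longrightarrow> u i t = v i t * \<phi> t"
  using \<phi>_pos[of t] by (simp add: v_def)

lemma v_pos: "t \<in> {t0..<tB} \<Longrightarrow> 0 < v i t"
  using \<phi>_pos[of t] by (simp add: v_def)

lemma u_le_v: "t \<in> {t0..<tB} \<Longrightarrow> u i t \<le> v i t"
  using \<phi>_le_1[of t] v_pos[of t i] by (simp add: u_eq_v mult_left_le)

lemma V_mono: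
  assumes "i \<in> {1..n}" "t0 \<le> s" "s \<le> t" "t < tB"
  shows "V i s \<le> V i t"
proof (rule deriv_nonneg_imp_le[OF \<open>s \<le> t\<close> subset_UNIV])
  fix x assume "x \<in> {s..t}"
  then have x: "x \<in> {t0..<tB}" using assms by auto
  then show "(V i has_real_derivative \<kappa> * rho x * u i x * \<phi> x) (at x)" by (rule der_V[OF assms(1)])
  show "0 \<le> \<kappa> * rho x * u i x * \<phi> x"
    using \<kappa>_pos rho_pos[OF late[OF x]] \<phi>_pos[OF x] by (simp add: less_imp_le)
qed

lemma v_mono:
  assumes "i \<in> {1..n}" "t0 \<le> s" "s \<le> t" "t < tB" "0 \<le> V i s"
  shows "v i s \<le> v i t"
proof (rule deriv_nonneg_imp_le[OF \<open>s \<le> t\<close> subset_UNIV])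
  fix x assume x: "x \<in> {s..t}"
  then show "(v i has_real_derivative V i x / (\<phi> x)\<^sup>2) (at x)" using assms by (intro der_v) auto
  show "0 \<le> V i x / (\<phi> x)\<^sup>2" using V_mono[of i s x] x assms by auto
qed

lemma v_antimono:
  assumes "i \<in> {1..n}" "t0 \<le> s" "s \<le> t" "t < tB"
    and V: "\<And>x. x \<in> {t0..<tB} \<Longrightarrow> V i x \<le> 0"
  shows "v i t \<le> v i s"
proof (rule deriv_nonpos_imp_ge[OF \<open>s \<le> t\<close> subset_UNIV])
  fix x assume "x \<in> {s..t}"
  then have x: "x \<in> {t0..<tB}" using assms by auto
  then show "(v i has_real_derivative V i x / (\<phi> x)\<^sup>2) (at x)" by (rule der_v[OF assms(1)])
  show "V i x / (\<phi> x)\<^sup>2 \<le> 0" using V[OF x] by (simp add: divide_nonpos_nonneg)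
qed

lemma v_1_not_eventually_bounded_below:
  assumes "0 < c"
  shows "\<not> (\<forall>\<^sub>F t in at_left tB. c \<le> v 1 t)"
proof
  assume "\<forall>\<^sub>F t in at_left tB. c \<le> v 1 t"
  with eventually_late have "\<forall>\<^sub>F t in at_left tB. c * cos 1 \<le> u 1 t"
  proof eventually_elim
    case (elim t)
    then show ?case
      unfolding u_eq_v[OF elim(1)] using \<open>0 < c\<close> \<phi>_ge cos_1_pos by (intro mult_mono) auto
  qed
  then show False using u_1_not_eventually_bounded_below[of "c * cos 1"] \<open>0 < c\<close> cos_1_pos by simp
qed

lemma V_1_nonpos:
  assumes t: "t \<in> {t0..<tB}"
  shows "V 1 t \<le> 0"
proof (rule ccontr)
  assume "\<not> V 1 t \<le> 0"
  have "t < tB" using t by simp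
  from eventually_in_at_left[OF this] have "\<forall>\<^sub>F s in at_left tB. v 1 t \<le> v 1 s"
    by eventually_elim (use t \<open>\<not> V 1 t \<le> 0\<close> n_pos in \<open>auto intro!: v_mono\<close>)
  then show False using v_1_not_eventually_bounded_below v_pos[OF t] by blast
qed

lemma v_1_lim: "(v 1 \<longlongrightarrow> 0) (at_left tB)"
proof (rule order_tendstoI)
  fix e :: real assume "e < 0"
  show "\<forall>\<^sub>F t in at_left tB. e < v 1 t"
    using eventually_late by eventually_elim (rule less_trans[OF \<open>e < 0\<close> v_pos])
next
  fix e :: real assume "0 < e"
  then have "\<exists>\<^sub>F t in at_left tB. v 1 t < e"
    using v_1_not_eventually_bounded_below by (simp add: frequently_def not_less)
  from frequently_ex[OF frequently_eventually_conj[OF this eventually_late]]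
  obtain s where s: "s \<in> {t0..<tB}" "v 1 s < e" by auto
  then have "s < tB" by simp
  from eventually_in_at_left[OF this] show "\<forall>\<^sub>F t in at_left tB. v 1 t < e"
  proof eventually_elim
    case (elim t)
    then show ?case using v_antimono[OF one_index _ _ _ V_1_nonpos, of s t] s by auto
  qed
qed

lemma u_1_lim: "(u 1 \<longlongrightarrow> 0) (at_left tB)"
proof (rule filterlim_at_left_transform[OF _ t0_less])
  show "((\<lambda>t. v 1 t * \<phi> t) \<longlongrightarrow> 0) (at_left tB)" using tendsto_mult[OF v_1_lim \<phi>_lim] by simp
qed (simp add: u_eq_v)

lemma v_1_mult_bounded_lim:
  assumes "\<And>t. t \<in> {t0..<tB} \<Longrightarrow> \<bar>f t\<bar> \<le> C"
  shows "((\<lambda>t. v 1 t * f t) \<longlongrightarrow> 0) (at_left tB)"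
proof (rule Lim_null_comparison)
  show "((\<lambda>t. v 1 t * C) \<longlongrightarrow> 0) (at_left tB)"
    using tendsto_mult[OF v_1_lim tendsto_const[of C]] by simp
  show "\<forall>\<^sub>F t in at_left tB. norm (v 1 t * f t) \<le> v 1 t * C"
    using eventually_late
  proof eventually_elim
    case (elim t)
    then show ?case using assms[of t] v_pos[of t 1] by (simp add: abs_mult mult_left_mono)
  qed
qed

section \<open>Products with the first mode\<close>

definition w :: "nat \<Rightarrow> real" where "w j = lam0 j - lam0 1"

definition P :: "nat \<Rightarrow> real \<Rightarrow> real" where "P j t = u 1 t * u j t"

text \<open>Up to a term that vanishes in the limit, \<open>\<beta> j\<close> is \<open>- u 1' * u j\<close>.\<close>

definition \<beta> :: "nat \<Rightarrow> real \<Rightarrow> real" where "\<beta> j t = - V 1 t * v j t"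

definition F :: "nat \<Rightarrow> real \<Rightarrow> real" where "F j t = \<kappa> * rho t * (P j t)\<^sup>2"

lemma P_pos: "0 < P j t"
  by (simp add: P_def)

lemma P_lam_diff:
  assumes "j \<in> {1..n}" "t \<in> {0..<tB}"
  shows "P j t * (lam j t - lam 1 t) = w j"
  using wronskian[OF one_index assms] assms(1) one_index by (simp add: P_def w_def lam_0)

lemma P_lam_1:
  assumes "t \<in> {t0..<tB}"
  shows "P j t * lam 1 t = - \<beta> j t + P j t * (\<psi> t / \<phi> t)"
  using \<phi>_pos[OF assms] by (simp add: \<beta>_def v_def V_def P_def field_simps)

lemma \<beta>_nonneg: "t \<in> {t0..<tB} \<Longrightarrow> 0 \<le> \<beta> j t"
  unfolding \<beta>_def using V_1_nonpos[of t] v_pos[of t j] by (intro mult_nonneg_nonneg) auto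

lemma wronskian_v:
  assumes "j \<in> {1..n}" "t \<in> {t0..<tB}"
  shows "w j - \<beta> j t = v 1 t * V j t"
  unfolding P_lam_diff[OF assms(1) late[OF assms(2)], symmetric]
  using \<phi>_pos[OF assms(2)] by (simp add: P_def \<beta>_def v_def V_def field_simps)

lemma der_v_1:
  assumes "t \<in> {t0..<tB}"
  shows "(v 1 has_real_derivative 1 / P j t * (- \<beta> j t) * v 1 t) (at t)"
  by (rule DERIV_cong[OF der_v[OF one_index assms]])
    (use \<phi>_pos[OF assms] in \<open>simp add: P_def \<beta>_def v_def power2_eq_square\<close>)

lemma der_v_wronskian:
  assumes j: "j \<in> {1..n}" and t: "t \<in> {t0..<tB}"
  shows "(v j has_real_derivative 1 / P j t * (w j - \<beta> j t) * v j t) (at t)"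
  by (rule DERIV_cong[OF der_v[OF assms]])
    (use \<phi>_pos[OF t] in \<open>simp add: wronskian_v[OF assms] P_def v_def power2_eq_square\<close>)

lemma der_\<beta>:
  assumes j: "j \<in> {1..n}" and t: "t \<in> {t0..<tB}"
  shows "(\<beta> j has_real_derivative 1 / P j t * (\<beta> j t * (w j - \<beta> j t) - F j t)) (at t)"
proof (rule DERIV_cong)
  show "(\<beta> j has_real_derivative - (\<kappa> * rho t * u 1 t * \<phi> t) * v j t +
      1 / P j t * (w j - \<beta> j t) * v j t * (- V 1 t)) (at t)"
    unfolding \<beta>_def[abs_def]
    by (intro DERIV_mult DERIV_minus der_V der_v_wronskian[OF j t, unfolded \<beta>_def] one_index j t)
  have "\<kappa> * rho t * u 1 t * \<phi> t * v j t = F j t / P j t"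
    using \<phi>_pos[OF t] by (simp add: F_def P_def v_def power2_eq_square)
  then show "- (\<kappa> * rho t * u 1 t * \<phi> t) * v j t + 1 / P j t * (w j - \<beta> j t) * v j t * (- V 1 t)
      = 1 / P j t * (\<beta> j t * (w j - \<beta> j t) - F j t)"
    by (simp add: \<beta>_def algebra_simps diff_divide_distrib)
qed

lemma limits_if_V_nonpos:
  assumes j: "j \<in> {1..n}" and V: "\<And>t. t \<in> {t0..<tB} \<Longrightarrow> V j t \<le> 0"
  shows "(\<beta> j \<longlongrightarrow> w j) (at_left tB)" "(P j \<longlongrightarrow> 0) (at_left tB)"
proof -
  have "\<bar>V j t\<bar> \<le> - V j t0" if "t \<in> {t0..<tB}" for t
    using V[OF that] V_mono[OF j, of t0 t] that by auto
  then have "((\<lambda>t. w j - v 1 t * V j t) \<longlongrightarrow> w j - 0) (at_left tB)"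
    by (intro tendsto_diff tendsto_const v_1_mult_bounded_lim)
  then have "(\<beta> j \<longlongrightarrow> w j - 0) (at_left tB)"
  proof (rule filterlim_at_left_transform[OF _ t0_less])
    show "w j - v 1 t * V j t = \<beta> j t" if "t \<in> {t0..<tB}" for t
      using wronskian_v[OF j that] by simp
  qed
  then show "(\<beta> j \<longlongrightarrow> w j) (at_left tB)" by simp
  have "\<bar>v j t\<bar> \<le> v j t0" if "t \<in> {t0..<tB}" for t
    using v_antimono[OF j _ _ _ V, of t0 t] v_pos[OF that, of j] that by auto
  then have "((\<lambda>t. v 1 t * v j t * (\<phi> t)\<^sup>2) \<longlongrightarrow> 0 * 1\<^sup>2) (at_left tB)"
    by (intro tendsto_intros v_1_mult_bounded_lim \<phi>_lim)
  then have "(P j \<longlongrightarrow> 0 * 1\<^sup>2) (at_left tB)"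
    by (rule filterlim_at_left_transform[OF _ t0_less]) (simp add: P_def u_eq_v power2_eq_square)
  then show "(P j \<longlongrightarrow> 0) (at_left tB)" by simp
qed

lemma u_affine:
  assumes "h \<in> {1..n}" "j \<in> {1..n}" "t \<in> {0..<tB}"
  shows "w h * (u j t - u 1 t) = w j * (u h t - u 1 t)"
  using u_affine_dependence[OF one_index assms] assms one_index by (simp add: w_def lam_0)

text \<open>All modes are combinations of \<open>u 1\<close> and any \<open>u h\<close> with \<open>w h > 0\<close>, and the contribution of
  \<open>u 1\<close> to \<open>\<beta>\<close> and \<open>P\<close> vanishes in the limit.\<close>

lemma limits_transfer:
  assumes h: "h \<in> {1..n}" and "0 < w h" and j: "j \<in> {1..n}"
    and \<beta>_lim: "(\<beta> h \<longlongrightarrow> L) (at_left tB)" and P_lim: "(P h \<longlongrightarrow> 0) (at_left tB)"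
  shows "(\<beta> j \<longlongrightarrow> w j / w h * L) (at_left tB)" "(P j \<longlongrightarrow> 0) (at_left tB)"
proof -
  define r where "r = w j / w h"
  have u: "u j t = (1 - r) * u 1 t + r * u h t" if t: "t \<in> {t0..<tB}" for t
    using u_affine[OF h j late[OF t]] \<open>0 < w h\<close> by (simp add: r_def field_simps)
  have "w 1 = 0" by (simp add: w_def)
  note limits_1 = limits_if_V_nonpos[OF one_index V_1_nonpos, unfolded \<open>w 1 = 0\<close>]
  have "((\<lambda>t. (1 - r) * \<beta> 1 t + r * \<beta> h t) \<longlongrightarrow> (1 - r) * 0 + r * L) (at_left tB)"
    by (intro tendsto_intros \<beta>_lim limits_1)
  then have "(\<beta> j \<longlongrightarrow> (1 - r) * 0 + r * L) (at_left tB)"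
    by (rule filterlim_at_left_transform[OF _ t0_less])
      (simp add: \<beta>_def v_def u algebra_simps add_divide_distrib diff_divide_distrib)
  then show "(\<beta> j \<longlongrightarrow> w j / w h * L) (at_left tB)" by (simp add: r_def)
  have "((\<lambda>t. (1 - r) * P 1 t + r * P h t) \<longlongrightarrow> (1 - r) * 0 + r * 0) (at_left tB)"
    by (intro tendsto_intros P_lim limits_1)
  then have "(P j \<longlongrightarrow> (1 - r) * 0 + r * 0) (at_left tB)"
    by (rule filterlim_at_left_transform[OF _ t0_less]) (simp add: P_def u algebra_simps)
  then show "(P j \<longlongrightarrow> 0) (at_left tB)" by simp
qed

lemma products_tendsto:
  assumes j: "j \<in> {1..n}"
    and \<beta>_lim: "(\<beta> j \<longlongrightarrow> L) (at_left tB)" and P_lim: "(P j \<longlongrightarrow> 0) (at_left tB)"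
  shows "((\<lambda>t. deriv (u 1) t * u j t) \<longlongrightarrow> - L) (at_left tB)"
    and "((\<lambda>t. u 1 t * deriv (u j) t) \<longlongrightarrow> w j - L) (at_left tB)"
proof -
  have deriv_u: "deriv (u i) t = lam i t * u i t" if "i \<in> {1..n}" "t \<in> {t0..<tB}" for i t
    using der_u[OF that(1) late[OF that(2)]] at_late[OF that(2)] by (simp add: DERIV_imp_deriv)
  have "((\<lambda>t. - \<beta> j t + P j t * (\<psi> t / \<phi> t)) \<longlongrightarrow> - L + 0 * (0 / 1)) (at_left tB)"
    by (intro tendsto_intros \<beta>_lim P_lim \<phi>_lim \<psi>_lim) simp
  then have "((\<lambda>t. deriv (u 1) t * u j t) \<longlongrightarrow> - L + 0 * (0 / 1)) (at_left tB)"
  proof (rule filterlim_at_left_transform[OF _ t0_less])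
    fix t assume t: "t \<in> {t0..<tB}"
    show "- \<beta> j t + P j t * (\<psi> t / \<phi> t) = deriv (u 1) t * u j t"
      unfolding deriv_u[OF one_index t] using P_lam_1[OF t, of j] by (simp add: P_def mult_ac)
  qed
  then show first: "((\<lambda>t. deriv (u 1) t * u j t) \<longlongrightarrow> - L) (at_left tB)" by simp
  have "((\<lambda>t. w j + deriv (u 1) t * u j t) \<longlongrightarrow> w j + - L) (at_left tB)"
    by (intro tendsto_intros first)
  then have "((\<lambda>t. u 1 t * deriv (u j) t) \<longlongrightarrow> w j + - L) (at_left tB)"
  proof (rule filterlim_at_left_transform[OF _ t0_less])
    fix t assume t: "t \<in> {t0..<tB}"
    show "w j + deriv (u 1) t * u j t = u 1 t * deriv (u j) t"
      unfolding deriv_u[OF one_index t] deriv_u[OF j t]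
      using P_lam_diff[OF j late[OF t]] by (simp add: P_def algebra_simps)
  qed
  then show "((\<lambda>t. u 1 t * deriv (u j) t) \<longlongrightarrow> w j - L) (at_left tB)" by simp
qed

end

section \<open>Convergence across the spectral gap\<close>

locale spectral_gap = maximal_flow +
  fixes J m h :: nat
  assumes J_pos: "1 \<le> J" and m_pos: "1 \<le> m" and n_eq: "n = J + m" and h_eq: "h = J + 1"
    and low: "\<And>i. i \<in> {1..J} \<Longrightarrow> lam0 i = lam0 1"
    and gap: "lam0 1 < lam0 h"
    and high: "\<And>i. i \<in> {h..n} \<Longrightarrow> lam0 h \<le> lam0 i"
begin

lemma h_index: "h \<in> {1..n}"
  using m_pos by (simp add: n_eq h_eq)

lemma low_index: "i \<in> {1..J} \<Longrightarrow> i \<in> {1..n}" and high_index: "i \<in> {h..n} \<Longrightarrow> i \<in> {1..n}"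
  by (auto simp: n_eq h_eq)

lemma w_h_pos: "0 < w h"
  using gap by (simp add: w_def)

lemma w_high: "i \<in> {h..n} \<Longrightarrow> w h \<le> w i"
  using high by (simp add: w_def)

lemma w_high_pos: "i \<in> {h..n} \<Longrightarrow> 0 < w i"
  using w_high w_h_pos by (rule less_le_trans[rotated])

lemma indices_split: "{1..n} = {1..J} \<union> {h..n}" "{1..J} \<inter> {h..n} = {}"
  by (auto simp: n_eq h_eq)

lemma card_low: "card {1..J} = J" and card_high: "card {h..n} = m"
  by (simp_all add: n_eq h_eq)

lemma u_low: "i \<in> {1..J} \<Longrightarrow> t \<in> {0..<tB} \<Longrightarrow> u i t = u 1 t"
  using u_mono[of i 1 t] u_mono[of 1 i t] low_index[of i] one_index low[of i]
  by (simp add: lam_0 order_antisym)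

lemma sum_lam_ge:
  assumes t: "t \<in> {0..<tB}"
  shows "real J * lam 1 t + real m * lam h t \<le> (\<Sum>i=1..n. lam i t)"
proof -
  have "real (card {1..J}) * lam 1 t \<le> (\<Sum>i\<in>{1..J}. lam i t)"
    by (intro sum_bounded_below lam_1_le t low_index)
  moreover have "real (card {h..n}) * lam h t \<le> (\<Sum>i\<in>{h..n}. lam i t)"
  proof (rule sum_bounded_below)
    fix i assume i: "i \<in> {h..n}"
    show "lam h t \<le> lam i t"
      using lam_mono[OF h_index high_index[OF i] t] high[OF i]
      by (simp add: lam_0[OF h_index] lam_0[OF high_index[OF i]])
  qed
  moreover have "(\<Sum>i=1..n. lam i t) = (\<Sum>i\<in>{1..J}. lam i t) + (\<Sum>i\<in>{h..n}. lam i t)"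
    unfolding indices_split(1) by (rule sum.union_disjoint) (use indices_split(2) in auto)
  ultimately show ?thesis unfolding card_low card_high by linarith
qed

definition \<theta> :: "real \<Rightarrow> real" where "\<theta> t = (\<Prod>i\<in>{h..n}. u h t / u i t)"

definition \<theta>_lim :: real where "\<theta>_lim = (\<Prod>i\<in>{h..n}. w h / w i)"

lemma \<theta>_lim_pos: "0 < \<theta>_lim"
  unfolding \<theta>_lim_def using w_high_pos w_h_pos by (intro prod_pos) auto

lemma \<theta>_ge:
  assumes t: "t \<in> {0..<tB}"
  shows "\<theta>_lim \<le> \<theta> t"
  unfolding \<theta>_def \<theta>_lim_def
proof (intro prod_mono conjI)
  fix i assume i: "i \<in> {h..n}"
  show "0 \<le> w h / w i" using w_high_pos[OF i] w_h_pos by simp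
  have "0 \<le> (w i - w h) * u 1 t"
    using w_high[OF i] less_imp_le[OF u_pos] by (intro mult_nonneg_nonneg) auto
  then have "w h * u i t \<le> w i * u h t"
    using u_affine[OF h_index high_index[OF i] t]
    unfolding right_diff_distrib left_diff_distrib by linarith
  then show "w h / w i \<le> u h t / u i t" using w_high_pos[OF i] by (simp add: field_simps)
qed

lemma F_eq:
  assumes t: "t \<in> {0..<tB}"
  shows "F h t = \<kappa> * rho0 * \<theta> t * ((P h t)\<^sup>2 / (u 1 t ^ J * u h t ^ m))"
proof -
  have "(\<Prod>i=1..n. u i t) = (\<Prod>i\<in>{1..J}. u i t) * (\<Prod>i\<in>{h..n}. u i t)"
    unfolding indices_split(1) by (rule prod.union_disjoint) (use indices_split(2) in auto)
  also have "(\<Prod>i\<in>{1..J}. u i t) = (\<Prod>i\<in>{1..J}. u 1 t)" by (intro prod.cong refl u_low t)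
  also have "(\<Prod>i\<in>{h..n}. u i t) = u h t ^ m / \<theta> t"
    using prod_u_pos[of t "{h..n}"]
    by (simp add: \<theta>_def prod_dividef card_high del: card_atLeastAtMost)
  finally have "(\<Prod>i=1..n. u i t) = u 1 t ^ J * (u h t ^ m / \<theta> t)" by simp
  then show ?thesis by (simp add: F_def rho_eq[OF t] mult_ac)
qed

end

locale expanding_gap = spectral_gap +
  fixes t1 :: real
  assumes t1_late: "t1 \<in> {t0..<tB}" and V_h_t1: "0 < V h t1"
begin

lemma t1_less: "t1 < tB"
  using t1_late by simp

lemma late_after_t1: "t \<in> {t1..<tB} \<Longrightarrow> t \<in> {t0..<tB}"
  using t1_late by auto

lemma V_h_pos: "t \<in> {t1..<tB} \<Longrightarrow> 0 < V h t"
  using V_mono[OF h_index, of t1 t] V_h_t1 t1_late by auto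

lemma v_h_mono: "mono_on {t1..<tB} (v h)"
  using V_h_pos t1_late by (intro monotone_onI v_mono h_index) (auto intro: less_imp_le)

lemma u_h_bounded_below:
  obtains c where "0 < c" "\<And>t. t \<in> {t1..<tB} \<Longrightarrow> c \<le> u h t"
proof
  show "0 < v h t1 * cos 1" using v_pos[OF t1_late] cos_1_pos by simp
  show "v h t1 * cos 1 \<le> u h t" if t: "t \<in> {t1..<tB}" for t
    unfolding u_eq_v[OF late_after_t1[OF t]]
    using monotone_onD[OF v_h_mono, of t1 t] t t1_less cos_1_pos
      \<phi>_ge[OF late_after_t1[OF t]] v_pos[OF late_after_t1[OF t], of h]
    by (intro mult_mono) auto
qed

lemma u_h_convergent_or_at_top:
  obtains (convergent) L where "0 < L" "(u h \<longlongrightarrow> L) (at_left tB)"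
  | (at_top) "filterlim (u h) at_top (at_left tB)"
proof (cases "bdd_above (v h ` {t1..<tB})")
  case True
  obtain c where c: "0 < c" "\<And>t. t \<in> {t1..<tB} \<Longrightarrow> c \<le> u h t" using u_h_bounded_below by blast
  have "((\<lambda>t. v h t * \<phi> t) \<longlongrightarrow> (SUP t\<in>{t1..<tB}. v h t) * 1) (at_left tB)"
    by (intro tendsto_mult mono_on_bdd_above_tendsto_at_left[OF t1_less v_h_mono True] \<phi>_lim)
  then have lim: "(u h \<longlongrightarrow> (SUP t\<in>{t1..<tB}. v h t) * 1) (at_left tB)"
    by (rule filterlim_at_left_transform[OF _ t0_less]) (simp add: u_eq_v)
  moreover have "\<forall>\<^sub>F t in at_left tB. c \<le> u h t"
    using eventually_in_at_left[OF t1_less] by eventually_elim (rule c(2))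
  then have "c \<le> (SUP t\<in>{t1..<tB}. v h t) * 1" by (intro tendsto_lowerbound[OF lim]) auto
  ultimately show ?thesis using c(1) convergent by (meson less_le_trans)
next
  case False
  have "filterlim (\<lambda>t. \<phi> t * v h t) at_top (at_left tB)"
    by (rule filterlim_tendsto_pos_mult_at_top[OF \<phi>_lim zero_less_one
          mono_on_not_bdd_above_at_top_at_left[OF v_h_mono False]])
  then have "filterlim (u h) at_top (at_left tB)"
    by (rule filterlim_at_left_transform[OF _ t0_less]) (simp add: u_eq_v)
  then show ?thesis by (rule at_top)
qed

lemma inverse_u_h_convergent:
  obtains L where "((\<lambda>t. 1 / u h t) \<longlongrightarrow> L) (at_left tB)"
proof (cases rule: u_h_convergent_or_at_top)
  case (convergent L)
  then have "((\<lambda>t. 1 / u h t) \<longlongrightarrow> 1 / L) (at_left tB)" by (intro tendsto_intros) auto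
  then show ?thesis by (rule that)
next
  case at_top
  then have "((\<lambda>t. 1 / u h t) \<longlongrightarrow> 0) (at_left tB)"
    unfolding inverse_eq_divide[symmetric] by (rule tendsto_inverse_0_at_top)
  then show ?thesis by (rule that)
qed

lemma ratio_at_top: "filterlim (\<lambda>t. u h t / u 1 t) at_top (at_left tB)"
proof -
  obtain c where c: "0 < c" "\<And>t. t \<in> {t1..<tB} \<Longrightarrow> c \<le> u h t" using u_h_bounded_below by blast
  have "filterlim (\<lambda>t. inverse (u 1 t)) at_top (at_left tB)"
    by (rule filterlim_inverse_at_top[OF u_1_lim]) simp
  then have "filterlim (\<lambda>t. c * inverse (u 1 t)) at_top (at_left tB)"
    by (rule filterlim_tendsto_pos_mult_at_top[OF tendsto_const c(1)])
  moreover have "\<forall>\<^sub>F t in at_left tB. c * inverse (u 1 t) \<le> u h t / u 1 t"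
    using eventually_in_at_left[OF t1_less]
    by eventually_elim (use c in \<open>simp add: divide_inverse mult_right_mono less_imp_le\<close>)
  ultimately show ?thesis by (rule filterlim_at_top_mono)
qed

lemma \<theta>_tendsto: "(\<theta> \<longlongrightarrow> \<theta>_lim) (at_left tB)"
  unfolding \<theta>_def[abs_def] \<theta>_lim_def
proof (rule tendsto_prod)
  fix i assume i: "i \<in> {h..n}"
  have "((\<lambda>t. inverse (u h t / u 1 t)) \<longlongrightarrow> 0) (at_left tB)"
    using ratio_at_top by (rule tendsto_inverse_0_at_top)
  then have "((\<lambda>t. w h / ((w h - w i) * inverse (u h t / u 1 t) + w i)) \<longlongrightarrow>
      w h / ((w h - w i) * 0 + w i)) (at_left tB)"
    by (intro tendsto_intros) (use w_high_pos[OF i] in auto)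
  then have "((\<lambda>t. u h t / u i t) \<longlongrightarrow> w h / ((w h - w i) * 0 + w i)) (at_left tB)"
  proof (rule filterlim_at_left_transform[OF _ t0_less])
    fix t assume t: "t \<in> {t0..<tB}"
    have "w h * u i t = (w h - w i) * u 1 t + w i * u h t"
      using u_affine[OF h_index high_index[OF i] late[OF t]] by (simp add: algebra_simps)
    also have "\<dots> = ((w h - w i) * inverse (u h t / u 1 t) + w i) * u h t" by (simp add: field_simps)
    finally have "(w h - w i) * inverse (u h t / u 1 t) + w i = w h * u i t / u h t"
      by (simp add: eq_divide_eq)
    then show "w h / ((w h - w i) * inverse (u h t / u 1 t) + w i) = u h t / u i t"
      using w_h_pos by simp
  qed
  then show "((\<lambda>t. u h t / u i t) \<longlongrightarrow> w h / w i) (at_left tB)" by simp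
qed

lemma \<beta>_le:
  assumes t: "t \<in> {t1..<tB}"
  shows "\<beta> h t \<le> w h"
proof -
  have "0 < v 1 t * V h t" by (rule mult_pos_pos[OF v_pos[OF late_after_t1[OF t]] V_h_pos[OF t]])
  then show ?thesis using wronskian_v[OF h_index late_after_t1[OF t]] by linarith
qed

definition log_ratio :: "real \<Rightarrow> real" where "log_ratio t = ln (u h t / u 1 t) / w h"

lemma der_log_ratio:
  assumes t: "t \<in> {t0..<tB}"
  shows "(log_ratio has_real_derivative 1 / P h t) (at t)"
proof -
  have "((\<lambda>t. u h t / u 1 t) has_real_derivative w h / (u 1 t)\<^sup>2) (at t)"
    using der_ratio[OF one_index h_index late[OF t]] one_index h_index
    by (simp add: at_late[OF t] w_def lam_0)
  then have "(log_ratio has_real_derivative (w h / (u 1 t)\<^sup>2) / (u h t / u 1 t) / w h) (at t)"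
    unfolding log_ratio_def[abs_def]
    by (intro DERIV_cdivide DERIV_ln_divide[THEN DERIV_chain2, THEN DERIV_cong]) auto
  then show ?thesis using w_h_pos by (simp add: P_def power2_eq_square)
qed

lemma log_ratio_at_top: "filterlim log_ratio at_top (at_left tB)"
proof -
  have "filterlim (\<lambda>t. (1 / w h) * ln (u h t / u 1 t)) at_top (at_left tB)"
    by (rule filterlim_tendsto_pos_mult_at_top[OF tendsto_const _
          filterlim_compose[OF ln_at_top ratio_at_top]])
      (use w_h_pos in simp)
  then show ?thesis by (simp add: log_ratio_def[abs_def])
qed

sublocale forced_logistic t1 tB log_ratio "\<lambda>t. 1 / P h t" "w h" "\<beta> h" "F h"
proof
  fix t assume t: "t \<in> {t1..<tB}"
  show "(log_ratio has_real_derivative 1 / P h t) (at t)"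
    by (rule der_log_ratio[OF late_after_t1[OF t]])
  show "(\<beta> h has_real_derivative 1 / P h t * (\<beta> h t * (w h - \<beta> h t) - F h t)) (at t)"
    by (rule der_\<beta>[OF h_index late_after_t1[OF t]])
  show "\<beta> h t \<in> {0..w h}" using \<beta>_nonneg[OF late_after_t1[OF t]] \<beta>_le[OF t] by simp
qed (simp_all add: t1_less log_ratio_at_top P_pos)

definition p :: "real \<Rightarrow> real" where "p t = v 1 t * v h t"

lemma p_pos: "t \<in> {t0..<tB} \<Longrightarrow> 0 < p t"
  by (simp add: p_def v_pos)

lemma P_eq_p: "t \<in> {t0..<tB} \<Longrightarrow> P h t = p t * (\<phi> t)\<^sup>2"
  by (simp add: P_def p_def u_eq_v power2_eq_square)

lemma der_p:
  assumes t: "t \<in> {t0..<tB}"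
  shows "(p has_real_derivative (w h - 2 * \<beta> h t) / (\<phi> t)\<^sup>2) (at t)"
  unfolding p_def[abs_def]
proof (rule DERIV_cong[OF DERIV_mult[OF der_v[OF one_index t] der_v[OF h_index t]]])
  have "V 1 t * v h t + V h t * v 1 t = w h - 2 * \<beta> h t"
    using wronskian_v[OF h_index t] by (simp add: \<beta>_def mult_ac)
  then show "V 1 t / (\<phi> t)\<^sup>2 * v h t + V h t / (\<phi> t)\<^sup>2 * v 1 t = (w h - 2 * \<beta> h t) / (\<phi> t)\<^sup>2"
    by (simp add: add_divide_distrib[symmetric])
qed

lemma p_convergent:
  obtains L where "(p \<longlongrightarrow> L) (at_left tB)"
proof (rule deriv_bounded_tendsto_at_left[OF t1_less])
  fix t assume t: "t \<in> {t1..<tB}"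
  show "(p has_real_derivative (w h - 2 * \<beta> h t) / (\<phi> t)\<^sup>2) (at t within {t1..<tB})"
    using der_p[OF late_after_t1[OF t]] by (rule has_field_derivative_at_within)
  have "\<bar>w h - 2 * \<beta> h t\<bar> \<le> w h" using \<beta>_bounds[OF t] by auto
  moreover have "(cos 1)\<^sup>2 \<le> (\<phi> t)\<^sup>2"
    using \<phi>_ge[OF late_after_t1[OF t]] cos_1_pos by (intro power_mono) auto
  ultimately show "\<bar>(w h - 2 * \<beta> h t) / (\<phi> t)\<^sup>2\<bar> \<le> w h / (cos 1)\<^sup>2"
    unfolding abs_divide using cos_1_pos by (intro frac_le) auto
qed

text \<open>A positive limit would bound the speed of the clock, which would then stop before \<open>tB\<close>.\<close>

lemma P_lim: "(P h \<longlongrightarrow> 0) (at_left tB)"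
proof -
  obtain L where "(p \<longlongrightarrow> L) (at_left tB)" by (rule p_convergent)
  then have "((\<lambda>t. p t * (\<phi> t)\<^sup>2) \<longlongrightarrow> L * 1\<^sup>2) (at_left tB)" by (intro tendsto_intros \<phi>_lim)
  then have lim: "(P h \<longlongrightarrow> L * 1\<^sup>2) (at_left tB)"
    by (rule filterlim_at_left_transform[OF _ t0_less]) (simp add: P_eq_p)
  have "0 \<le> L" using tendsto_lowerbound[OF lim, of 0] by (simp add: less_imp_le P_pos)
  moreover have "\<not> 0 < L"
  proof
    assume "0 < L"
    then have "\<forall>\<^sub>F t in at_left tB. L / 2 < P h t" by (intro order_tendstoD(1)[OF lim]) simp
    then obtain d where d: "d < tB" "\<And>t. d < t \<Longrightarrow> t < tB \<Longrightarrow> L / 2 < P h t"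
      unfolding eventually_at_left_field by blast
    obtain s where s: "max t0 d < s" "s < tB" using dense[of "max t0 d" tB] d t0_less by auto
    obtain C where "(log_ratio \<longlongrightarrow> C) (at_left tB)"
    proof (rule deriv_bounded_tendsto_at_left[OF s(2)])
      fix t assume "t \<in> {s..<tB}"
      then have t: "t \<in> {t0..<tB}" "d < t" using s by auto
      show "(log_ratio has_real_derivative 1 / P h t) (at t within {s..<tB})"
        using der_log_ratio[OF t(1)] by (rule has_field_derivative_at_within)
      show "\<bar>1 / P h t\<bar> \<le> 1 / (L / 2)"
        unfolding abs_divide using d(2)[OF t(2)] t \<open>0 < L\<close> by (intro frac_le) auto
    qed
    then show False
      using not_tendsto_and_filterlim_at_infinity[OF _ _
          filterlim_at_top_imp_at_infinity[OF log_ratio_at_top]]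
      by simp
  qed
  ultimately show ?thesis using lim by simp
qed

lemma \<beta>_limit_ge:
  assumes L: "(\<beta> h \<longlongrightarrow> L) (at_left tB)"
  shows "w h \<le> 2 * L"
proof (rule ccontr)
  assume "\<not> w h \<le> 2 * L"
  then have "\<forall>\<^sub>F t in at_left tB. \<beta> h t < w h / 2" by (intro order_tendstoD(2)[OF L]) auto
  then obtain d where d: "d < tB" "\<And>t. d < t \<Longrightarrow> t < tB \<Longrightarrow> \<beta> h t < w h / 2"
    unfolding eventually_at_left_field by blast
  obtain s where s: "max t0 d < s" "s < tB" using dense[of "max t0 d" tB] d t0_less by auto
  have "p s * (cos 1)\<^sup>2 \<le> P h t" if t: "t \<in> {s..<tB}" for t
  proof -
    have "p s \<le> p t"
    proof (rule deriv_nonneg_imp_le[of s t UNIV p])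
      fix x assume "x \<in> {s..t}"
      then have x: "x \<in> {t0..<tB}" "d < x" using s t by auto
      then show "(p has_real_derivative (w h - 2 * \<beta> h x) / (\<phi> x)\<^sup>2) (at x)" by (intro der_p)
      show "0 \<le> (w h - 2 * \<beta> h x) / (\<phi> x)\<^sup>2" using d(2)[OF x(2)] x(1) by simp
    qed (use t in auto)
    moreover have "t \<in> {t0..<tB}" using s t by auto
    ultimately show ?thesis
      unfolding P_eq_p[OF \<open>t \<in> {t0..<tB}\<close>]
      using \<phi>_ge[of t] p_pos[of t] cos_1_pos by (intro mult_mono power_mono) auto
  qed
  then have "p s * (cos 1)\<^sup>2 \<le> 0"
    using eventually_in_at_left[OF s(2)]
    by (intro tendsto_lowerbound[OF P_lim]) (auto elim: eventually_mono)
  moreover have "0 < p s * (cos 1)\<^sup>2" using p_pos[of s] s cos_1_pos by simp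
  ultimately show False by simp
qed

lemma \<beta>_convergent_if_J_le_2:
  assumes "J \<le> 2" "J \<le> m"
  obtains L where "(\<beta> h \<longlongrightarrow> L) (at_left tB)" "L \<in> {0..w h}"
proof -
  obtain d e where d: "m = J + d" and e: "2 = J + e" using assms by (meson le_iff_add)
  obtain C where "((\<lambda>t. 1 / u h t) \<longlongrightarrow> C) (at_left tB)" by (rule inverse_u_h_convergent)
  then have "((\<lambda>t. \<kappa> * rho0 * \<theta> t * (P h t ^ e * (1 / u h t) ^ d)) \<longlongrightarrow>
      \<kappa> * rho0 * \<theta>_lim * (0 ^ e * C ^ d)) (at_left tB)"
    by (intro tendsto_intros \<theta>_tendsto P_lim)
  then have "(F h \<longlongrightarrow> \<kappa> * rho0 * \<theta>_lim * (0 ^ e * C ^ d)) (at_left tB)"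
    by (rule filterlim_at_left_transform[OF _ t0_less])
      (simp add: F_eq[OF late] e d P_def power_add power_mult_distrib power_divide)
  then show ?thesis using that by (rule convergent_if_forcing_convergent)
qed

lemma \<beta>_convergent_if_J_2_m_1:
  assumes "J = 2" "m = 1"
  obtains L where "(\<beta> h \<longlongrightarrow> L) (at_left tB)" "L \<in> {0..w h}"
proof -
  have F: "\<kappa> * rho0 * \<theta> t * u h t = F h t" if "t \<in> {t0..<tB}" for t
    by (simp add: F_eq[OF late[OF that]] P_def assms power2_eq_square)
  have coeff: "((\<lambda>t. \<kappa> * rho0 * \<theta> t) \<longlongrightarrow> \<kappa> * rho0 * \<theta>_lim) (at_left tB)"
    by (intro tendsto_intros \<theta>_tendsto)
  show ?thesis
  proof (cases rule: u_h_convergent_or_at_top)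
    case (convergent C)
    from filterlim_at_left_transform[OF tendsto_mult[OF coeff convergent(2)] t0_less F]
    show ?thesis using that by (rule convergent_if_forcing_convergent)
  next
    case at_top
    have "filterlim (\<lambda>t. \<kappa> * rho0 * \<theta> t * u h t) at_top (at_left tB)"
      by (rule filterlim_tendsto_pos_mult_at_top[OF coeff _ at_top])
        (use \<kappa>_pos rho0_pos \<theta>_lim_pos in simp)
    then have "filterlim (F h) at_top (at_left tB)"
      using t0_less F by (rule filterlim_at_left_transform)
    then show ?thesis using forcing_not_at_top by blast
  qed
qed

lemma not_3_le_J_and_m_le_J:
  assumes "3 \<le> J" "m \<le> J"
  shows False
proof -
  obtain r where r: "J = m + r" using \<open>m \<le> J\<close> by (meson le_iff_add)
  define e where "e = J - 2"
  have e: "J = e + 2" "0 < e" using \<open>3 \<le> J\<close> by (auto simp: e_def)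
  obtain c where c: "0 < c" "\<And>t. t \<in> {t1..<tB} \<Longrightarrow> c \<le> u h t" using u_h_bounded_below by blast
  have "filterlim (\<lambda>t. inverse (P h t)) at_top (at_left tB)"
    by (rule filterlim_inverse_at_top[OF P_lim]) (simp add: P_pos)
  then have "filterlim (\<lambda>t. inverse (P h t) ^ e) at_top (at_left tB)"
    using e(2) by (intro filterlim_pow_at_top)
  then have "filterlim (\<lambda>t. \<kappa> * rho0 * \<theta>_lim * c ^ r * inverse (P h t) ^ e) at_top (at_left tB)"
    by (rule filterlim_tendsto_pos_mult_at_top[OF tendsto_const, rotated])
      (use \<kappa>_pos rho0_pos \<theta>_lim_pos c in simp)
  moreover have "\<forall>\<^sub>F t in at_left tB. \<kappa> * rho0 * \<theta>_lim * c ^ r * inverse (P h t) ^ e \<le> F h t"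
    using eventually_in_at_left[OF t1_less]
  proof eventually_elim
    case (elim t)
    have "u 1 t ^ J * (u h t ^ m * u h t ^ r) = P h t ^ J"
      by (simp add: P_def power_mult_distrib r power_add)
    also have "\<dots> = P h t ^ e * (P h t)\<^sup>2" by (simp add: e(1) power_add power2_eq_square)
    finally have "(P h t)\<^sup>2 / (u 1 t ^ J * u h t ^ m) = u h t ^ r * inverse (P h t) ^ e"
      using P_pos[of h t] by (simp add: field_simps)
    then have "F h t = \<kappa> * rho0 * \<theta> t * u h t ^ r * inverse (P h t) ^ e"
      by (simp add: F_eq[OF late[OF late_after_t1[OF elim]]])
    moreover have "\<kappa> * rho0 * \<theta>_lim * c ^ r * inverse (P h t) ^ e \<le> \<dots>"
      using \<kappa>_pos rho0_pos \<theta>_ge[OF late[OF late_after_t1[OF elim]]] \<theta>_lim_pos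
        c(1) c(2)[OF elim] P_pos[of h t]
      by (intro mult_mono power_mono mult_nonneg_nonneg zero_le_power) auto
    ultimately show ?case by simp
  qed
  ultimately have "filterlim (F h) at_top (at_left tB)" by (rule filterlim_at_top_mono)
  then show False using forcing_not_at_top by simp
qed

text \<open>Up to bounded factors \<open>Q\<close> is \<open>F\<close>, but its logarithmic derivative with respect to the time
  \<open>log_ratio\<close> is exactly affine in \<open>\<beta>\<close>.\<close>

definition Q :: "real \<Rightarrow> real" where "Q t = 1 / (v 1 t ^ (J - 2) * v h t ^ (m - 2))"

definition F' :: "real \<Rightarrow> real" where
  "F' t = F h t * (2 * (lam 1 t + lam h t) - (\<Sum>i=1..n. lam i t))"

lemma der_F:
  assumes t: "t \<in> {t0..<tB}"
  shows "(F h has_real_derivative F' t) (at t)"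
proof -
  note late_t = late[OF t] at_late[OF t]
  have "((\<lambda>t. \<kappa> * rho t * (u 1 t * u h t)\<^sup>2) has_real_derivative F' t) (at t)"
    by (rule derivative_eq_intros der_rho[OF late_t(1), unfolded late_t(2)]
        der_u[OF one_index late_t(1), unfolded late_t(2)]
        der_u[OF h_index late_t(1), unfolded late_t(2)] refl)+
      (simp add: F'_def F_def P_def algebra_simps power2_eq_square)
  then show ?thesis by (simp add: F_def[abs_def] P_def)
qed

lemma Q_pos: "t \<in> {t0..<tB} \<Longrightarrow> 0 < Q t"
  by (simp add: Q_def v_pos)

lemma der_Q:
  assumes t: "t \<in> {t0..<tB}"
  shows "(Q has_real_derivative
    1 / P h t * (real (J - 2) * \<beta> h t - real (m - 2) * (w h - \<beta> h t)) * Q t) (at t)"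
proof -
  define y where "y = 1 / P h t * (real (J - 2) * \<beta> h t - real (m - 2) * (w h - \<beta> h t))"
  define R where "R t = v 1 t ^ (J - 2) * v h t ^ (m - 2)" for t
  have power: "((\<lambda>t. f t ^ k) has_real_derivative real k * z * f t ^ k) (at t)"
    if "(f has_real_derivative z * f t) (at t)" for f z k
    by (rule DERIV_cong[OF DERIV_power[OF that]]) (cases k; simp)
  have "(R has_real_derivative - y * R t) (at t)"
    unfolding R_def[abs_def]
    by (rule DERIV_cong[OF DERIV_mult[OF
          power[OF der_v_1[OF t, of h]] power[OF der_v_wronskian[OF h_index t]]]])
      (simp add: y_def algebra_simps diff_divide_distrib add_divide_distrib)
  moreover have "R t \<noteq> 0" using v_pos[OF t] by (simp add: R_def less_imp_neq[symmetric])
  ultimately have "((\<lambda>t. inverse (R t)) has_real_derivative y * inverse (R t)) (at t)"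
    by (intro DERIV_cong[OF DERIV_inverse']) auto
  then show ?thesis unfolding Q_def[abs_def] R_def y_def inverse_eq_divide .
qed

lemma F'_le:
  assumes "2 \<le> J" "2 \<le> m" and t: "t \<in> {t0..<tB}"
  shows "F' t \<le> 1 / P h t * (real (J - 2) * \<beta> h t - real (m - 2) * (w h - \<beta> h t)) * F h t"
proof -
  define a b where "a = real (J - 2)" and "b = real (m - 2)"
  have ab: "real J = a + 2" "real m = b + 2" "0 \<le> a" "0 \<le> b"
    using assms(1,2) by (auto simp: a_def b_def)
  have lam_1: "lam 1 t = \<psi> t / \<phi> t - \<beta> h t / P h t"
    using P_lam_1[OF t, of h] P_pos[of h t] by (simp add: field_simps)
  have "lam h t = lam 1 t + w h / P h t"
    using P_lam_diff[OF h_index late[OF t]] P_pos[of h t] by (simp add: field_simps)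
  then have lam_h: "lam h t = \<psi> t / \<phi> t + (w h - \<beta> h t) / P h t"
    unfolding lam_1 by (simp add: diff_divide_distrib)
  have "0 \<le> (a + b) * (\<psi> t / \<phi> t)" using ab \<psi>_nonneg[OF t] \<phi>_pos[OF t] by simp
  moreover have "2 * (lam 1 t + lam h t) - (\<Sum>i=1..n. lam i t) \<le> - a * lam 1 t - b * lam h t"
    using sum_lam_ge[OF late[OF t]] by (simp add: ab algebra_simps)
  moreover have "- a * lam 1 t - b * lam h t
      = 1 / P h t * (a * \<beta> h t - b * (w h - \<beta> h t)) - (a + b) * (\<psi> t / \<phi> t)"
    unfolding lam_1 lam_h by (simp add: algebra_simps diff_divide_distrib add_divide_distrib)
  ultimately have "2 * (lam 1 t + lam h t) - (\<Sum>i=1..n. lam i t)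
      \<le> 1 / P h t * (a * \<beta> h t - b * (w h - \<beta> h t))" by linarith
  moreover have "0 \<le> F h t" using \<kappa>_pos rho_pos[OF late[OF t]] by (simp add: F_def)
  ultimately show ?thesis
    unfolding F'_def a_def b_def by (subst mult.commute) (rule mult_right_mono)
qed

lemma F_ge_Q:
  assumes "2 \<le> J" "2 \<le> m" and t: "t \<in> {t0..<tB}"
  shows "\<kappa> * rho0 * \<theta>_lim * Q t \<le> F h t"
proof -
  define a b where "a = J - 2" and "b = m - 2"
  then have ab: "J = a + 2" "m = b + 2" using assms(1,2) by auto
  have "(P h t)\<^sup>2 / (u 1 t ^ J * u h t ^ m) = 1 / (u 1 t ^ a * u h t ^ b)"
    by (simp add: P_def ab power_add power_mult_distrib power2_eq_square)
  moreover have "u 1 t ^ a * u h t ^ b \<le> v 1 t ^ a * v h t ^ b"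
    using u_le_v[OF t] less_imp_le[OF u_pos] less_imp_le[OF v_pos[OF t]]
    by (intro mult_mono power_mono zero_le_power)
  then have "Q t \<le> 1 / (u 1 t ^ a * u h t ^ b)"
    unfolding Q_def a_def[symmetric] b_def[symmetric] by (intro frac_le) simp_all
  ultimately show ?thesis
    unfolding F_eq[OF late[OF t]]
    using \<kappa>_pos rho0_pos \<theta>_lim_pos \<theta>_ge[OF late[OF t]] Q_pos[OF t]
    by (intro mult_mono) (auto intro!: mult_nonneg_nonneg)
qed

lemma \<beta>_convergent_if_3_le_J_less_m:
  assumes "3 \<le> J" "J < m"
  obtains L where "(\<beta> h \<longlongrightarrow> L) (at_left tB)" "L \<in> {0..w h}"
proof -
  define c where "c = real (J - 2) + real (m - 2)"
  define \<beta>\<^sub>0 where "\<beta>\<^sub>0 = real (m - 2) * w h / c"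
  have "0 < c" using assms by (simp add: c_def)
  then have rate: "real (J - 2) * \<beta> h t - real (m - 2) * (w h - \<beta> h t) = c * (\<beta> h t - \<beta>\<^sub>0)" for t
    by (simp add: \<beta>\<^sub>0_def c_def field_simps)
  interpret lotka_volterra t1 tB log_ratio "\<lambda>t. 1 / P h t" "w h" "\<beta> h" "F h" F' Q \<beta>\<^sub>0 c
    "\<kappa> * rho0 * \<theta>_lim"
  proof
    fix t assume "t \<in> {t1..<tB}"
    then have t: "t \<in> {t0..<tB}" by (rule late_after_t1)
    show "(F h has_real_derivative F' t) (at t)" by (rule der_F[OF t])
    show "F' t \<le> 1 / P h t * (c * (\<beta> h t - \<beta>\<^sub>0)) * F h t"
      using F'_le[OF _ _ t] assms unfolding rate by simp
    show "(Q has_real_derivative 1 / P h t * (c * (\<beta> h t - \<beta>\<^sub>0)) * Q t) (at t)"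
      using der_Q[OF t] unfolding rate .
    show "0 < Q t" by (rule Q_pos[OF t])
    show "\<kappa> * rho0 * \<theta>_lim * Q t \<le> F h t" by (rule F_ge_Q[OF _ _ t]) (use assms in auto)
  next
    show "0 < c" by fact
    show "0 < \<kappa> * rho0 * \<theta>_lim" using \<kappa>_pos rho0_pos \<theta>_lim_pos by simp
    have "c < 2 * real (m - 2)" using assms by (auto simp: c_def)
    then show "w h < 2 * \<beta>\<^sub>0"
      using w_h_pos \<open>0 < c\<close> mult_strict_right_mono[of c "2 * real (m - 2)" "w h"]
      by (simp add: \<beta>\<^sub>0_def field_simps)
  qed
  show ?thesis using that by (rule lotka_volterra_convergent)
qed

lemma \<beta>_convergent:
  obtains L where "(\<beta> h \<longlongrightarrow> L) (at_left tB)" "w h \<le> 2 * L" "L \<le> w h"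
proof -
  have "J \<le> 2 \<and> J \<le> m \<or> J = 2 \<and> m = 1 \<or> 3 \<le> J \<and> m \<le> J \<or> 3 \<le> J \<and> J < m"
    using J_pos m_pos by arith
  then consider (J_le_2) "J \<le> 2" "J \<le> m" | (J_2_m_1) "J = 2" "m = 1"
    | (m_le_J) "3 \<le> J" "m \<le> J" | (J_less_m) "3 \<le> J" "J < m"
    by blast
  then obtain L where "(\<beta> h \<longlongrightarrow> L) (at_left tB)" "L \<in> {0..w h}"
  proof cases
    case J_le_2
    then show ?thesis using that by (rule \<beta>_convergent_if_J_le_2)
  next
    case J_2_m_1
    then show ?thesis using that by (rule \<beta>_convergent_if_J_2_m_1)
  next
    case m_le_J
    then show ?thesis using not_3_le_J_and_m_le_J by blast
  next
    case J_less_m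
    then show ?thesis using that by (rule \<beta>_convergent_if_3_le_J_less_m)
  qed
  then show ?thesis using \<beta>_limit_ge that by simp
qed

end

context spectral_gap
begin

lemma gap_limits:
  obtains L where "(\<beta> h \<longlongrightarrow> L) (at_left tB)" "(P h \<longlongrightarrow> 0) (at_left tB)" "w h \<le> 2 * L" "L \<le> w h"
proof (cases "\<exists>t1\<in>{t0..<tB}. 0 < V h t1")
  case True
  then obtain t1 where t1: "t1 \<in> {t0..<tB}" "0 < V h t1" by blast
  interpret expanding_gap n k cb rho0 tB lam0 lam rho J m h t1 by unfold_locales (fact t1)+
  obtain L where "(\<beta> h \<longlongrightarrow> L) (at_left tB)" "w h \<le> 2 * L" "L \<le> w h" by (rule \<beta>_convergent)
  then show ?thesis using P_lim that by blast
next
  case False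
  then have "V h t \<le> 0" if "t \<in> {t0..<tB}" for t using that by (auto simp: not_less)
  then show ?thesis using limits_if_V_nonpos[OF h_index] w_h_pos that[of "w h"] by simp
qed

lemma products_convergent:
  assumes j: "j \<in> {h..n}"
  shows "\<exists>p q. 0 \<le> q \<and> q \<le> p \<and>
    ((\<lambda>t. deriv (u 1) t * u j t) \<longlongrightarrow> - p) (at_left tB) \<and>
    ((\<lambda>t. u 1 t * deriv (u j) t) \<longlongrightarrow> q) (at_left tB)"
proof -
  obtain L where L: "(\<beta> h \<longlongrightarrow> L) (at_left tB)" "(P h \<longlongrightarrow> 0) (at_left tB)" "w h \<le> 2 * L" "L \<le> w h"
    by (rule gap_limits)
  define r where "r = w j / w h"
  have r: "0 < r" "w j = r * w h" using w_high_pos[OF j] w_h_pos by (simp_all add: r_def)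
  note lims = limits_transfer[OF h_index w_h_pos high_index[OF j] L(1,2), folded r_def]
  have "0 \<le> w j - r * L" using L(4) r by (simp add: mult_left_mono)
  moreover have "w j - r * L \<le> r * L"
    using mult_left_mono[OF L(3), of r] r by (simp add: algebra_simps)
  ultimately show ?thesis using products_tendsto[OF high_index[OF j] lims] by blast
qed

end

theorem theorem3p7:
  fixes n J j :: nat and k cb rho0 tB :: real
    and lam0 :: "nat \<Rightarrow> real" and lam :: "nat \<Rightarrow> real \<Rightarrow> real" and rho :: "real \<Rightarrow> real"
  assumes "n \<ge> 2" and "k > 0" and "cb > 0" and "rho0 > 0"
    and "1 \<le> J" and "J \<le> n"
    and "\<forall>i\<in>{1..J}. lam0 i = lam0 1"
    and "J < n \<longrightarrow> lam0 J < lam0 (J + 1)"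
    and "\<forall>i. J + 1 \<le> i \<and> i < n \<longrightarrow> lam0 i \<le> lam0 (i + 1)"
    and "0 < tB"
    and "maximal_solution n k cb rho0 lam0 tB lam rho"
    and "J < j" and "j \<le> n"
  shows "\<exists>p q. 0 \<le> q \<and> q \<le> p \<and>
    ((\<lambda>t. deriv (u_fun lam 1) t * u_fun lam j t) \<longlongrightarrow> - p) (at_left tB) \<and>
    ((\<lambda>t. u_fun lam 1 t * deriv (u_fun lam j) t) \<longlongrightarrow> q) (at_left tB)"
proof -
  have sol: "is_solution n k cb rho0 lam0 tB lam rho"
    using assms(11) by (simp add: maximal_solution_def)
  have low: "lam0 i = lam0 1" if "i \<in> {1..J}" for i using assms(7) that by blast
  have gap: "lam0 1 < lam0 (J + 1)" using low[of J] assms(5,8,12,13) by simp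
  have high: "lam0 (J + 1) \<le> lam0 i" if "i \<in> {J + 1..n}" for i
    using lift_Suc_mono_le_on[of "J + 1" n lam0 i] assms(9) that by simp
  have min: "lam0 1 \<le> lam0 i" if "i \<in> {1..n}" for i
    using low[of i] high[of i] gap that by (cases "i \<le> J") auto
  interpret spectral_gap n k cb rho0 tB lam0 lam rho J "n - J" "J + 1"
    by unfold_locales (fact assms sol min low gap high | use assms(1,5,12,13) in simp)+
  show ?thesis using products_convergent[of j] assms(12,13) by simp
qed

end
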